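(* Let $(\nu,x_0)\in\Omega$, and let $u_0=\nu^2-\nu$, $u_{n+1}=u_n^2-\nu$ for $n\ge0$. Write $K_n=K^{\nu,x_0}_n$, $K=K^{\nu,x_0}$. (1) If $u_0-x_0$ is not a square of an integer, then the only proper subfields of $K$ are the fields $K_n$, $n\ge0$. (2) If $u_0-x_0=a^2$ for an integer $a$ and $\nu\ge3$, then the only proper subfields of $K$ are the fields $K_n$ ($n\ge0$) together with the two quadratic fields $\mathbb{Q}(\sqrt{2(\nu-a)})$ and $\mathbb{Q}(\sqrt{2(\nu+a)})$, which are contained in $K_2$. Moreover, there are infinitely many pairs $(\nu,x_0)\in\Omega$ for which this case occurs. (3) The only proper subfield of $K^{2,1}$ of infinite degree over $\mathbb{Q}$ is $K^{2,0}$. We have $K^{2,1}=K^{2,0}(\sqrt3)$, and for each $n\ge1$, $K^{2,1}_{n+1}=K^{2,0}_n(\sqrt3)$ with $K^{2,0}_n\neq K^{2,1}_{n+1}$. Moreover, setting $M_n=\mathbb{Q}(\sqrt3\,x^{2,0}_n)$, the subfields of $K^{2,1}$ are exactly: $\mathbb{Q}$, $K^{2,0}$, $K^{2,1}$, and for each $n\ge1$ the three pairwise distinct fields $K^{2,0}_n$, $K^{2,1}_n$, $M_n$, which are the only subfields of $K^{2,1}$ of degree $2^n$ over $\mathbb{Q}$; the inclusions of degree $2$ among these are $\mathbb{Q}\subset K^{2,0}_1,\ \mathbb{Q}\subset K^{2,1}_1,\ \mathbb{Q}\subset M_1$, and for every $n\ge1$: $K^{2,0}_n\subset K^{2,0}_{n+1}$,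 $K^{2,0}_n\subset M_{n+1}$, $K^{2,0}_n\subset K^{2,1}_{n+1}$, $M_n\subset K^{2,1}_{n+1}$, $K^{2,1}_n\subset K^{2,1}_{n+1}$, together with $K^{2,0}\subset K^{2,1}$ (and $M_{n+1}\not\supseteq M_n$).
   Context: For integers $\nu\ge2$ and $x_0\ge0$, define $x^{\nu,x_0}_{n+1}=\pm\sqrt{\nu+x^{\nu,x_0}_n}$ for $n\ge0$ (any choice of sign at each step), $K^{\nu,x_0}_n=\mathbb{Q}(x^{\nu,x_0}_n)$ and $K^{\nu,x_0}=\bigcup_{n\ge0}K^{\nu,x_0}_n$. $\Omega$ is the set of pairs $(\nu,x_0)$ such that $[K^{\nu,x_0}_{n+1}:K^{\nu,x_0}_n]=2$ for every $n\ge0$ and $K^{\nu,x_0}$ is totally real. The pairs $(2,0)$ and $(2,1)$ lie in $\Omega$. *)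

theory Defs
  imports Complex_Main "HOL-Algebra.Generated_Fields" "HOL-Algebra.Embedded_Algebras"
    "HOL-Algebra.Algebraic_Closure_Type"
begin

text \<open>All fields are subfields of the complex numbers, the latter regarded as a ring record.\<close>

abbreviation CC :: "complex ring"
  where "CC \<equiv> ring_of_type_algebra"

definition adjoin :: "complex set \<Rightarrow> complex set \<Rightarrow> complex set"
  where "adjoin F S = generate_field CC (F \<union> S)"

definition subfields_of :: "complex set \<Rightarrow> complex set set"
  where "subfields_of K = {F. subfield F CC \<and> F \<subseteq> K}"

definition proper_subfields_of :: "complex set \<Rightarrow> complex set set"
  where "proper_subfields_of K = {F. subfield F CC \<and> F \<subset> K}"

definition has_degree :: "complex set \<Rightarrow> complex set \<Rightarrow> nat \<Rightarrow> bool"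
  where "has_degree E F d \<longleftrightarrow> F \<subseteq> E \<and> ring.dimension CC d F E"

definition infinite_degree :: "complex set \<Rightarrow> complex set \<Rightarrow> bool"
  where "infinite_degree E F \<longleftrightarrow> F \<subseteq> E \<and> (\<nexists>d. has_degree E F d)"

definition totally_real :: "complex set \<Rightarrow> bool"
  where "totally_real K \<longleftrightarrow> (\<forall>\<sigma>\<in>ring_hom (CC\<lparr>carrier := K\<rparr>) CC. \<sigma> ` K \<subseteq> \<real>)"

text \<open>The sequence \<open>s\<close> records the choice of sign at each step.\<close>

primrec xseq :: "int \<Rightarrow> int \<Rightarrow> (nat \<Rightarrow> bool) \<Rightarrow> nat \<Rightarrow> complex"
  where
    "xseq \<nu> x0 s 0 = of_int x0"
  | "xseq \<nu> x0 s (Suc n) =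
       (if s n then csqrt (of_int \<nu> + xseq \<nu> x0 s n) else - csqrt (of_int \<nu> + xseq \<nu> x0 s n))"

definition Kn :: "int \<Rightarrow> int \<Rightarrow> (nat \<Rightarrow> bool) \<Rightarrow> nat \<Rightarrow> complex set"
  where "Kn \<nu> x0 s n = adjoin \<rat> {xseq \<nu> x0 s n}"

definition Kinf :: "int \<Rightarrow> int \<Rightarrow> (nat \<Rightarrow> bool) \<Rightarrow> complex set"
  where "Kinf \<nu> x0 s = (\<Union>n. Kn \<nu> x0 s n)"

text \<open>When every step has degree 2, different sign choices give conjugate generators, so the
  conditions below hold for all sign choices as soon as they hold for one.\<close>

definition Omega :: "(int \<times> int) set"
  where "Omega = {(\<nu>, x0). \<nu> \<ge> 2 \<and> x0 \<ge> 0 \<and>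
    (\<forall>s. (\<forall>n. has_degree (Kn \<nu> x0 s (Suc n)) (Kn \<nu> x0 s n) 2) \<and> totally_real (Kinf \<nu> x0 s))}"

primrec u :: "int \<Rightarrow> nat \<Rightarrow> int"
  where
    "u \<nu> 0 = \<nu>\<^sup>2 - \<nu>"
  | "u \<nu> (Suc n) = (u \<nu> n)\<^sup>2 - \<nu>"

definition sqrtC :: "int \<Rightarrow> complex"
  where "sqrtC d = csqrt (of_int d)"

definition Mn :: "(nat \<Rightarrow> bool) \<Rightarrow> nat \<Rightarrow> complex set"
  where "Mn s n = adjoin \<rat> {sqrtC 3 * xseq 2 0 s n}"

end

theory Submission
  imports Defs
begin

text \<open>
  A proper subfield of an iterated quadratic extension \<open>T\<close> of the rationals lies in a subfield of
  index two, and such a subfield is the fixed field of an involution \<open>\<tau>\<close> of \<open>T\<close>; so it suffices to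
  know the involutions of the fields \<open>K\<^sub>n\<close>. Let \<open>x\<^sub>k\<close> be the first generator moved by \<open>\<tau>\<close>, so that
  \<open>\<tau> x\<^sub>k = - x\<^sub>k\<close>. If \<open>k < n\<close>, then \<open>x\<^sub>k\<^sub>+\<^sub>1 \<tau> x\<^sub>k\<^sub>+\<^sub>1\<close> is fixed by \<open>\<tau>\<close> and is a square root of
  \<open>u\<^sub>0 - x\<^sub>k\<^sub>-\<^sub>1\<close>. Norms down the tower turn such a root into an integral square root of \<open>u\<^sub>j - x\<^sub>0\<close>,
  and this is excluded for \<open>j \<ge> 1\<close> because \<open>u\<^sub>j\<close> lies just below the square of \<open>u\<^sub>j\<^sub>-\<^sub>1\<close>. What remains is
  \<open>k = n\<close>, with fixed field \<open>K\<^sub>n\<^sub>-\<^sub>1\<close>, and, if \<open>u\<^sub>0 - x\<^sub>0 = a\<^sup>2\<close>, the case \<open>k = 1\<close>, where the fixed field is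
  generated by \<open>x\<^sub>2 \<plusminus> a / x\<^sub>2\<close>, a square root of \<open>2 (\<nu> \<plusminus> a)\<close>; another norm shows \<open>n = 2\<close> there.

  For \<open>\<nu> = 2\<close> the map \<open>t \<mapsto> t\<^sup>3 - 3 t\<close> takes the tower over \<open>1\<close> to a tower over \<open>0\<close>, which gives
  \<open>K\<^sub>n\<^sub>+\<^sub>1 = L\<^sub>n(\<surd>3)\<close> for the two towers \<open>K\<close> over \<open>1\<close> and \<open>L\<close> over \<open>0\<close>. Every involution of \<open>L\<^sub>n\<^sub>+\<^sub>1(\<surd>3)\<close> fixes
  \<open>L\<^sub>n\<close>, so the subfields of index two are those of a biquadratic extension of \<open>L\<^sub>n\<close>.
\<close>

section \<open>Subfields of the complex numbers\<close>

lemma CC_simps [simp]: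
  "carrier CC = UNIV" "\<one>\<^bsub>CC\<^esub> = 1" "\<zero>\<^bsub>CC\<^esub> = 0" "a \<otimes>\<^bsub>CC\<^esub> b = a * b" "a \<oplus>\<^bsub>CC\<^esub> b = a + b"
  by (auto simp: ring_of_type_algebra_def)

lemma field_CC: "field CC" by rule

interpretation CC: cring CC by rule

lemma CC_a_inv [simp]: "\<ominus>\<^bsub>CC\<^esub> a = - a"
  by (rule CC.minus_equality) auto

lemma CC_m_inv [simp]: "a \<noteq> 0 \<Longrightarrow> inv\<^bsub>CC\<^esub> a = inverse a"
  by (rule CC.comm_inv_char) auto

lemma subfieldI_CC:
  assumes "1 \<in> F" "\<And>a b. a \<in> F \<Longrightarrow> b \<in> F \<Longrightarrow> a + b \<in> F" "\<And>a. a \<in> F \<Longrightarrow> - a \<in> F"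
    "\<And>a b. a \<in> F \<Longrightarrow> b \<in> F \<Longrightarrow> a * b \<in> F" "\<And>a. a \<in> F \<Longrightarrow> a \<noteq> 0 \<Longrightarrow> inverse a \<in> F"
  shows "subfield F CC"
proof (rule field.subfieldI'[OF field_CC])
  show "subring F CC" by (rule CC.subringI) (use assms in auto)
  show "inv\<^bsub>CC\<^esub> k \<in> F" if "k \<in> F - {\<zero>\<^bsub>CC\<^esub>}" for k using that assms(5) by auto
qed

context
  fixes F :: "complex set"
  assumes F: "subfield F CC"
begin

lemma subfield_1: "1 \<in> F" and subfield_0: "0 \<in> F"
  using subringE[OF subfieldE(1)[OF F]] by auto

lemma subfield_add: "a \<in> F \<Longrightarrow> b \<in> F \<Longrightarrow> a + b \<in> F"
  and subfield_uminus: "a \<in> F \<Longrightarrow> - a \<in> F"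
  and subfield_mult: "a \<in> F \<Longrightarrow> b \<in> F \<Longrightarrow> a * b \<in> F"
  using subringE[OF subfieldE(1)[OF F]] by auto

lemma subfield_diff: "a \<in> F \<Longrightarrow> b \<in> F \<Longrightarrow> a - b \<in> F"
  using subfield_add[of a "- b"] subfield_uminus[of b] by simp

lemma subfield_inverse: "a \<in> F \<Longrightarrow> inverse a \<in> F"
  using CC.subfield_m_inv(1)[OF F, of a] subfield_0 by (cases "a = 0") auto

lemma subfield_divide: "a \<in> F \<Longrightarrow> b \<in> F \<Longrightarrow> a / b \<in> F"
  by (simp add: divide_inverse subfield_mult subfield_inverse)

lemma subfield_power: "a \<in> F \<Longrightarrow> a ^ n \<in> F"
  by (induction n) (auto simp: subfield_1 subfield_mult)

lemma subfield_of_nat: "of_nat n \<in> F"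
  by (induction n) (auto simp: subfield_0 subfield_1 subfield_add)

lemma subfield_of_int: "of_int k \<in> F"
  by (cases k) (auto simp: subfield_of_nat subfield_uminus subfield_diff subfield_1)

lemma subfield_numeral: "numeral k \<in> F"
  using subfield_of_nat[of "numeral k"] by simp

lemma subfield_Rats: "a \<in> \<rat> \<Longrightarrow> a \<in> F"
  by (metis Rats_cases' subfield_divide subfield_of_int)

lemma subfield_prod: "(\<And>i. i \<in> I \<Longrightarrow> f i \<in> F) \<Longrightarrow> prod f I \<in> F"
  by (induction I rule: infinite_finite_induct) (auto simp: subfield_1 subfield_mult)

end

lemmas subfield_closed = subfield_1 subfield_0 subfield_add subfield_uminus subfield_mult subfield_diff
  subfield_inverse subfield_divide subfield_power subfield_of_nat subfield_of_int subfield_numeral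

lemma Rats_subset: "subfield F CC \<Longrightarrow> \<rat> \<subseteq> F"
  using subfield_Rats by blast

lemma subfield_Rats_CC: "subfield \<rat> CC"
  by (rule subfieldI_CC) auto

lemma subfield_Int: "subfield F CC \<Longrightarrow> subfield G CC \<Longrightarrow> subfield (F \<inter> G) CC"
  by (rule subfieldI_CC) (auto simp: subfield_closed)

lemma subfield_adjoin: "subfield (adjoin F S) CC"
  unfolding adjoin_def by (rule field.generate_field_is_subfield[OF field_CC]) auto

lemma adjoin_incl: "F \<subseteq> adjoin F S" "S \<subseteq> adjoin F S"
  unfolding adjoin_def by (auto intro: generate_field.incl)

lemma adjoin_mem: "z \<in> adjoin F {z}"
  using adjoin_incl by blast

lemma adjoin_least: "subfield G CC \<Longrightarrow> F \<subseteq> G \<Longrightarrow> S \<subseteq> G \<Longrightarrow> adjoin F S \<subseteq> G"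
  unfolding adjoin_def by (rule field.generate_field_min_subfield1[OF field_CC]) auto

lemma adjoin_absorb: "subfield F CC \<Longrightarrow> S \<subseteq> F \<Longrightarrow> adjoin F S = F"
  using adjoin_least[of F F S] adjoin_incl[of F S] by auto

lemma adjoin_Rats_eqI:
  assumes "z \<in> adjoin \<rat> {w}" "w \<in> adjoin \<rat> {z}"
  shows "adjoin \<rat> {z} = adjoin \<rat> {w}"
  using assms by (intro equalityI adjoin_least) (auto simp: subfield_adjoin Rats_subset)

lemma adjoin_uminus: "adjoin F {- z} = adjoin F {z}"
proof (intro equalityI adjoin_least)
  show "{- z} \<subseteq> adjoin F {z}" "{z} \<subseteq> adjoin F {- z}"
    using subfield_uminus[OF subfield_adjoin adjoin_mem, of z F]
      subfield_uminus[OF subfield_adjoin adjoin_mem, of "- z" F] by auto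
qed (auto simp: subfield_adjoin adjoin_incl)

lemma adjoin_sqrt_cong: "z\<^sup>2 = w\<^sup>2 \<Longrightarrow> adjoin F {z} = adjoin F {w}"
  by (metis adjoin_uminus power2_eq_iff)

text \<open>Every norm argument below ends here: once a square root has been pushed down to the
  rationals it is integral, and a statement about integer squares applies.\<close>

lemma of_int_square_in_RatsD:
  assumes "b \<in> \<rat>" "b\<^sup>2 = of_int k"
  shows "\<exists>a::int. k = a\<^sup>2 \<and> (b::complex) = of_int a"
proof -
  obtain r :: rat where r: "b = of_rat r" using assms(1) by (auto elim: Rats_cases)
  have "of_rat (r\<^sup>2) = (of_rat (of_int k) :: complex)"
    using assms(2) r by (simp add: of_rat_power)
  hence r2: "r\<^sup>2 = of_int k" by (simp only: of_rat_eq_iff)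
  obtain p q where pq: "quotient_of r = (p, q)" by force
  have q: "q > 0" "coprime p q" "r = of_int p / of_int q"
    using pq quotient_of_denom_pos quotient_of_coprime quotient_of_div by blast+
  have "(of_int (p\<^sup>2) :: rat) = of_int (k * q\<^sup>2)"
    using r2 q by (simp add: power_divide divide_eq_eq)
  hence "p\<^sup>2 = k * q\<^sup>2" by (simp only: of_int_eq_iff)
  hence "q\<^sup>2 dvd p\<^sup>2" by simp
  hence "q dvd p" by simp
  hence "q = 1" using q by (metis coprime_absorb_right zdvd1_eq abs_of_pos)
  thus ?thesis using q r r2 by (intro exI[of _ p]) (auto simp flip: of_int_power)
qed

section \<open>Quadratic extensions and involutions\<close>

text \<open>Every extension of degree two inside the complex numbers has this form
  (\<open>has_degree_quadext\<close>); a square root as generator makes coordinates and conjugation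
  explicit.\<close>

definition quadext :: "complex set \<Rightarrow> complex set \<Rightarrow> bool" where
  "quadext E K \<longleftrightarrow> subfield E CC \<and> (\<exists>z. z\<^sup>2 \<in> E \<and> z \<notin> E \<and> K = adjoin E {z})"

lemma quadextI: "subfield E CC \<Longrightarrow> z\<^sup>2 \<in> E \<Longrightarrow> z \<notin> E \<Longrightarrow> quadext E (adjoin E {z})"
  unfolding quadext_def by blast

lemma quadext_subfield: "quadext E K \<Longrightarrow> subfield E CC" "quadext E K \<Longrightarrow> subfield K CC"
  unfolding quadext_def by (auto simp: subfield_adjoin)

lemma quadext_psubset: "quadext E K \<Longrightarrow> E \<subset> K"
  unfolding quadext_def using adjoin_incl adjoin_mem by blast

lemma adjoin_sqrt_eq:
  assumes E: "subfield E CC" and z: "z\<^sup>2 \<in> E"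
  shows "adjoin E {z} = {a + b * z | a b. a \<in> E \<and> b \<in> E}"
proof (cases "z \<in> E")
  case True
  have "{a + b * z | a b. a \<in> E \<and> b \<in> E} = E"
  proof (intro equalityI subsetI)
    fix c assume "c \<in> E"
    thus "c \<in> {a + b * z | a b. a \<in> E \<and> b \<in> E}"
      using subfield_0[OF E] by (intro CollectI exI[of _ c] exI[of _ 0]) auto
  qed (use E True in \<open>auto simp: subfield_closed\<close>)
  thus ?thesis using True E by (simp add: adjoin_absorb)
next
  case False
  let ?S = "{a + b * z | a b. a \<in> E \<and> b \<in> E}"
  have I: "a + b * z \<in> ?S" if "a \<in> E" "b \<in> E" for a b using that by blast
  show ?thesis
  proof (intro equalityI adjoin_least)
    show "subfield ?S CC"
    proof (rule subfieldI_CC)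
      show "1 \<in> ?S" using I[of 1 0] E by (simp add: subfield_closed)
    next
      fix c d assume "c \<in> ?S" "d \<in> ?S"
      then obtain a b a' b' where
        *: "c = a + b * z" "d = a' + b' * z" "a \<in> E" "b \<in> E" "a' \<in> E" "b' \<in> E" by blast
      show "c + d \<in> ?S"
        using I[of "a + a'" "b + b'"] * E by (simp add: subfield_closed algebra_simps)
      have "c * d = (a * a' + b * b' * z\<^sup>2) + (a * b' + b * a') * z"
        by (simp add: * algebra_simps power2_eq_square)
      thus "c * d \<in> ?S" using I[of "a * a' + b * b' * z\<^sup>2" "a * b' + b * a'"] * E z
        by (simp add: subfield_closed)
    next
      fix c assume "c \<in> ?S"
      then obtain a b where *: "c = a + b * z" "a \<in> E" "b \<in> E" by blast
      show "- c \<in> ?S" using I[of "- a" "- b"] * E by (simp add: subfield_closed)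
      assume "c \<noteq> 0"
      \<comment> \<open>The norm of \<open>c\<close>. If it vanished, so would the conjugate
        \<open>a - b * z\<close>, and \<open>z = a / b\<close> would lie in
        \<open>E\<close>.\<close>
      have nz: "a\<^sup>2 - b\<^sup>2 * z\<^sup>2 \<noteq> 0"
      proof
        assume "a\<^sup>2 - b\<^sup>2 * z\<^sup>2 = 0"
        hence "(a + b * z) * (a - b * z) = 0" by (simp add: algebra_simps power2_eq_square)
        hence "a = b * z" using \<open>c \<noteq> 0\<close> * by auto
        hence "b \<noteq> 0" "z = a / b" using * \<open>c \<noteq> 0\<close> by auto
        thus False using False * E by (metis subfield_divide)
      qed
      let ?n = "a\<^sup>2 - b\<^sup>2 * z\<^sup>2"
      have "c * (a - b * z) = ?n" by (simp add: * algebra_simps power2_eq_square)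
      hence "inverse c = (a - b * z) / ?n" using nz \<open>c \<noteq> 0\<close> by (simp add: field_simps)
      also have "\<dots> = a / ?n + (- b / ?n) * z" by (simp add: diff_divide_distrib)
      finally show "inverse c \<in> ?S" using I[of "a / ?n" "- b / ?n"] * E z
        by (simp add: subfield_closed)
    qed
    show "E \<subseteq> ?S" using I[of _ 0] E by (auto simp: subfield_closed)
    show "{z} \<subseteq> ?S" using I[of 0 1] E by (auto simp: subfield_closed)
    show "?S \<subseteq> adjoin E {z}"
      using adjoin_incl[of E] adjoin_mem[of z E] by (auto intro!: subfield_closed subfield_adjoin)
  qed
qed

lemma adjoin_sqrt_cases:
  assumes "subfield E CC" "z\<^sup>2 \<in> E" "c \<in> adjoin E {z}"
  obtains a b where "a \<in> E" "b \<in> E" "c = a + b * z"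
  using assms adjoin_sqrt_eq[of E z] by blast

text \<open>The square of \<open>a + b * z\<close> has the mixed term \<open>2 * a * b * z\<close>.
  With \<open>c\<^sup>2\<close> in \<open>E\<close> and \<open>b\<close> nonzero this forces
  \<open>a = 0\<close>, as otherwise one could solve for \<open>z\<close> in
  \<open>E\<close>.\<close>

lemma adjoin_sqrt_square:
  assumes E: "subfield E CC" and z: "z\<^sup>2 \<in> E" "z \<notin> E"
    and c: "c \<in> adjoin E {z}" "c\<^sup>2 \<in> E" "c \<notin> E"
  obtains b where "b \<in> E" "c = b * z"
proof -
  obtain a b where *: "a \<in> E" "b \<in> E" "c = a + b * z" using adjoin_sqrt_cases[OF E z(1) c(1)] .
  have "a = 0"
  proof (rule ccontr)
    assume "a \<noteq> 0"
    have "b \<noteq> 0" using * c by auto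
    have "z = (c\<^sup>2 - a\<^sup>2 - b\<^sup>2 * z\<^sup>2) / (2 * a * b)"
      using \<open>a \<noteq> 0\<close> \<open>b \<noteq> 0\<close> by (simp add: * field_simps power2_eq_square)
    thus False using z c * E by (metis subfield_closed(5,6,8,9,12))
  qed
  thus ?thesis using that * by simp
qed

text \<open>An element of \<open>E\<close> outside \<open>F\<close> has a nonzero
  \<open>z\<close>-coordinate, so \<open>z\<close> can be recovered inside \<open>E\<close>.\<close>

lemma quadext_between:
  assumes "subfield F CC" "z\<^sup>2 \<in> F" "subfield E CC" "F \<subseteq> E" "E \<subset> adjoin F {z}"
  shows "E = F"
proof (rule ccontr)
  assume "E \<noteq> F"
  then obtain c where c: "c \<in> E" "c \<notin> F" using assms by blast
  then obtain a b where *: "a \<in> F" "b \<in> F" "c = a + b * z"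
    using adjoin_sqrt_cases[OF assms(1,2), of c] assms(5) by blast
  have "b \<noteq> 0" using * c by auto
  hence "z = (c - a) / b" using * by simp
  hence "z \<in> E" using * c assms by (metis subfield_diff subfield_divide subsetD)
  hence "adjoin F {z} \<subseteq> E" using assms by (intro adjoin_least) auto
  thus False using assms by blast
qed

lemma quadext_between_cases:
  assumes "quadext F K" "subfield E CC" "F \<subseteq> E" "E \<subseteq> K"
  shows "E = F \<or> E = K"
  using assms quadext_between[of F _ E] unfolding quadext_def by blast

text \<open>The identity counts as an involution, and values outside \<open>K\<close> are arbitrary;
  nontriviality enters as \<open>fixed_field K \<tau> \<noteq> K\<close>.\<close>

definition involution_on :: "complex set \<Rightarrow> (complex \<Rightarrow> complex) \<Rightarrow> bool" where
  "involution_on K \<tau> \<longleftrightarrow> subfield K CC \<and> (\<forall>a\<in>K. \<tau> a \<in> K \<and> \<tau> (\<tau> a) = a) \<and>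
     (\<forall>a\<in>K. \<forall>b\<in>K. \<tau> (a + b) = \<tau> a + \<tau> b \<and> \<tau> (a * b) = \<tau> a * \<tau> b)"

definition fixed_field :: "complex set \<Rightarrow> (complex \<Rightarrow> complex) \<Rightarrow> complex set" where
  "fixed_field K \<tau> = {a \<in> K. \<tau> a = a}"

context
  fixes K \<tau>
  assumes \<tau>: "involution_on K \<tau>"
begin

lemma involution_subfield: "subfield K CC"
  and involution_mem: "a \<in> K \<Longrightarrow> \<tau> a \<in> K"
  and involution_invol: "a \<in> K \<Longrightarrow> \<tau> (\<tau> a) = a"
  and involution_add: "a \<in> K \<Longrightarrow> b \<in> K \<Longrightarrow> \<tau> (a + b) = \<tau> a + \<tau> b"
  and involution_mult: "a \<in> K \<Longrightarrow> b \<in> K \<Longrightarrow> \<tau> (a * b) = \<tau> a * \<tau> b"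
  using \<tau> unfolding involution_on_def by blast+

lemma involution_0: "\<tau> 0 = 0"
  using involution_add[of 0 0] subfield_0[OF involution_subfield] by simp

lemma involution_1: "\<tau> 1 = 1"
proof -
  have "\<tau> 1 * \<tau> 1 = \<tau> 1" using involution_mult[of 1 1] subfield_1[OF involution_subfield] by simp
  \<comment> \<open>Otherwise \<open>1 = \<tau> (\<tau> 1) = \<tau> 0 = 0\<close>.\<close>
  moreover have "\<tau> 1 \<noteq> 0"
    using involution_invol[of 1] subfield_1[OF involution_subfield] involution_0 by force
  ultimately show ?thesis by simp
qed

lemma involution_uminus: "a \<in> K \<Longrightarrow> \<tau> (- a) = - \<tau> a"
  using involution_add[of a "- a"] subfield_uminus[OF involution_subfield] involution_0
  by (metis add.inverse_unique ab_group_add_class.ab_left_minus add.commute)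

lemma involution_inverse: "a \<in> K \<Longrightarrow> \<tau> (inverse a) = inverse (\<tau> a)"
  using involution_mult[of a "inverse a"] subfield_inverse[OF involution_subfield] involution_0
    involution_1 by (cases "a = 0") (auto simp: inverse_unique)

lemma involution_power: "a \<in> K \<Longrightarrow> \<tau> (a ^ n) = \<tau> a ^ n"
  by (induction n) (auto simp: involution_1 involution_mult subfield_power[OF involution_subfield])

lemma subfield_fixed_field: "subfield (fixed_field K \<tau>) CC"
  by (rule subfieldI_CC)
     (auto simp: fixed_field_def subfield_closed involution_subfield involution_1 involution_add
       involution_mult involution_uminus involution_inverse)

lemma involution_Rats: "a \<in> \<rat> \<Longrightarrow> \<tau> a = a"
  using subfield_Rats[OF subfield_fixed_field, of a] by (simp add: fixed_field_def)

lemma involution_of_int: "\<tau> (of_int k) = of_int k"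
  by (rule involution_Rats) auto

lemma involution_sqrt:
  assumes "z \<in> K" "\<tau> (z\<^sup>2) = z\<^sup>2"
  shows "\<tau> z = z \<or> \<tau> z = - z"
  using assms involution_power[of z 2] by (auto simp: power2_eq_iff)

end

lemma quadext_conj:
  assumes E: "subfield E CC" and z: "z\<^sup>2 \<in> E" "z \<notin> E"
  obtains \<tau> where "involution_on (adjoin E {z}) \<tau>" "fixed_field (adjoin E {z}) \<tau> = E" "\<tau> z = - z"
proof -
  \<comment> \<open>Conjugation. The description is well defined because coordinates are unique
    (\<open>uniq\<close>), as \<open>z\<close> is not in \<open>E\<close>.\<close>
  define \<tau> where "\<tau> c = (THE d. \<exists>a b. a \<in> E \<and> b \<in> E \<and> c = a + b * z \<and> d = a - b * z)" for c
  have uniq: "a = a' \<and> b = b'"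
    if "a + b * z = a' + b' * z" "a \<in> E" "b \<in> E" "a' \<in> E" "b' \<in> E" for a b a' b'
  proof -
    have eq: "(b - b') * z = a' - a" using that(1) by (simp add: algebra_simps)
    have "b = b'"
    proof (rule ccontr)
      assume "b \<noteq> b'"
      hence "z = (a' - a) / (b - b')" using eq by (simp add: field_simps)
      thus False using that z E by (metis subfield_diff subfield_divide)
    qed
    thus ?thesis using that(1) by simp
  qed
  have \<tau>: "\<tau> (a + b * z) = a - b * z" if "a \<in> E" "b \<in> E" for a b
    unfolding \<tau>_def by (rule the_equality) (use that uniq in blast)+
  have mem: "a + b * z \<in> adjoin E {z}" if "a \<in> E" "b \<in> E" for a b
    using that adjoin_sqrt_eq[OF E z(1)] by blast
  note [elim] = adjoin_sqrt_cases[OF E z(1)]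
  have 1: "\<tau> c \<in> adjoin E {z} \<and> \<tau> (\<tau> c) = c" if c: "c \<in> adjoin E {z}" for c
  proof -
    obtain a b where *: "a \<in> E" "b \<in> E" "c = a + b * z" using c by blast
    have "\<tau> c = a + (- b) * z" using * \<tau> by simp
    thus ?thesis using * mem[of a "- b"] \<tau>[of a "- b"] E by (simp add: subfield_closed)
  qed
  have 2: "\<tau> (c + d) = \<tau> c + \<tau> d \<and> \<tau> (c * d) = \<tau> c * \<tau> d"
    if c: "c \<in> adjoin E {z}" and d: "d \<in> adjoin E {z}" for c d
  proof -
    obtain a b where *: "a \<in> E" "b \<in> E" "c = a + b * z" using c by blast
    obtain a' b' where **: "a' \<in> E" "b' \<in> E" "d = a' + b' * z" using d by blast
    have s: "c + d = (a + a') + (b + b') * z" by (simp add: * ** algebra_simps)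
    have p: "c * d = (a * a' + b * b' * z\<^sup>2) + (a * b' + b * a') * z"
      by (simp add: * ** algebra_simps power2_eq_square)
    have "\<tau> (c + d) = (a + a') - (b + b') * z"
      unfolding s using * ** E z by (intro \<tau>) (auto simp: subfield_closed)
    moreover have "\<tau> (c * d) = (a * a' + b * b' * z\<^sup>2) - (a * b' + b * a') * z"
      unfolding p using * ** E z by (intro \<tau>) (auto simp: subfield_closed)
    moreover have "\<tau> c = a - b * z" "\<tau> d = a' - b' * z" using * ** \<tau> by auto
    ultimately show ?thesis by (simp only:) (simp add: algebra_simps power2_eq_square)
  qed
  have 3: "fixed_field (adjoin E {z}) \<tau> = E"
  proof (intro equalityI subsetI)
    fix c assume "c \<in> fixed_field (adjoin E {z}) \<tau>"
    hence c: "c \<in> adjoin E {z}" "\<tau> c = c" by (auto simp: fixed_field_def)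
    obtain a b where *: "a \<in> E" "b \<in> E" "c = a + b * z" using c by blast
    hence "a - b * z = a + b * z" using c \<tau> by simp
    hence "b * z = 0" by (simp add: algebra_simps)
    thus "c \<in> E" using * by auto
  next
    fix c assume "c \<in> E"
    thus "c \<in> fixed_field (adjoin E {z}) \<tau>"
      using \<tau>[of c 0] mem[of c 0] E by (auto simp: fixed_field_def subfield_closed)
  qed
  have 4: "\<tau> z = - z" using \<tau>[of 0 1] E by (simp add: subfield_closed)
  show ?thesis by (rule that[OF _ 3 4]) (use 1 2 in \<open>auto simp: involution_on_def subfield_adjoin\<close>)
qed

lemma quadext_involution:
  assumes "quadext E K"
  obtains \<tau> where "involution_on K \<tau>" "fixed_field K \<tau> = E"
  using assms quadext_conj unfolding quadext_def by metis

text \<open>The norm \<open>c * \<tau> c\<close> under conjugation of \<open>z\<close> lies in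
  \<open>E\<close>, and its square is the norm of \<open>\<alpha> + \<beta> * z\<close>. This
  carries a square root one level down a tower.\<close>

lemma quadext_norm_square:
  assumes E: "subfield E CC" and z: "z\<^sup>2 \<in> E" "z \<notin> E"
    and c: "c \<in> adjoin E {z}" "c\<^sup>2 = \<alpha> + \<beta> * z" and ab: "\<alpha> \<in> E" "\<beta> \<in> E"
  shows "\<exists>d\<in>E. d\<^sup>2 = \<alpha>\<^sup>2 - \<beta>\<^sup>2 * z\<^sup>2"
proof -
  obtain \<tau> where \<tau>: "involution_on (adjoin E {z}) \<tau>" "fixed_field (adjoin E {z}) \<tau> = E" "\<tau> z = - z"
    using quadext_conj[OF E z] .
  have mem: "\<alpha> \<in> adjoin E {z}" "\<beta> \<in> adjoin E {z}" "z \<in> adjoin E {z}"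
    using ab adjoin_incl(1)[of E "{z}"] adjoin_mem[of z E] by auto
  have fix_ab: "\<tau> \<alpha> = \<alpha>" "\<tau> \<beta> = \<beta>" using ab \<tau>(2) by (auto simp: fixed_field_def)
  have "(\<tau> c)\<^sup>2 = \<tau> (\<alpha> + \<beta> * z)" using involution_power[OF \<tau>(1) c(1), of 2] c(2) by simp
  also have "\<dots> = \<alpha> - \<beta> * z"
    using mem fix_ab \<tau>(3) by (simp add: involution_add[OF \<tau>(1)] involution_mult[OF \<tau>(1)]
        subfield_mult subfield_adjoin)
  finally have "(c * \<tau> c)\<^sup>2 = \<alpha>\<^sup>2 - \<beta>\<^sup>2 * z\<^sup>2"
    by (simp add: power_mult_distrib c(2)) (simp add: algebra_simps power2_eq_square)
  moreover have "c * \<tau> c \<in> fixed_field (adjoin E {z}) \<tau>"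
    using c(1) by (simp add: fixed_field_def involution_mult[OF \<tau>(1)] involution_invol[OF \<tau>(1)]
        involution_mem[OF \<tau>(1)] subfield_mult subfield_adjoin mult.commute)
  ultimately show ?thesis using \<tau>(2) by blast
qed

subsection \<open>Degrees\<close>

lemma line_extension_CC: "CC.line_extension K a E = {k * a + v | k v. k \<in> K \<and> v \<in> E}"
  using CC.line_extension_mem_iff[of _ K a E] by auto

lemma quadext_has_degree:
  assumes "quadext F E"
  shows "has_degree E F 2"
proof -
  from assms obtain z where z: "subfield F CC" "z\<^sup>2 \<in> F" "z \<notin> F" "E = adjoin F {z}"
    unfolding quadext_def by blast
  have "CC.dimension (Suc 1) F (CC.line_extension F z F)"
    using CC.Suc_dim[of z F 1 F] CC.dimension_one[OF z(1)] z(3) by simp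
  moreover have "CC.line_extension F z F = E"
    unfolding line_extension_CC z(4) adjoin_sqrt_eq[OF z(1,2)] by (auto simp: add.commute)
  ultimately show ?thesis
    unfolding has_degree_def using quadext_psubset[OF assms] by (simp add: numeral_2_eq_2)
qed

lemma has_degree_unique: "subfield F CC \<Longrightarrow> has_degree E F m \<Longrightarrow> has_degree E F n \<Longrightarrow> m = n"
  unfolding has_degree_def using CC.dimension_is_inj by blast

lemma has_degree_self: "subfield F CC \<Longrightarrow> has_degree F F 1"
  unfolding has_degree_def using CC.dimension_one by blast

lemma has_degree_quadext_step:
  assumes "subfield F CC" "has_degree E F n" "quadext E K"
  shows "has_degree K F (2 * n)"
proof -
  have "CC.dimension (n * 2) F K"
    using CC.telescopic_base[of F E n 2 K] assms quadext_subfield[of E K] quadext_has_degree[of E K]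
    unfolding has_degree_def by blast
  thus ?thesis using assms quadext_psubset[of E K] unfolding has_degree_def
    by (auto simp: mult.commute)
qed

text \<open>A basis of \<open>E\<close> stays independent in \<open>K\<close>. It serves to see that
  a field containing a whole tower has infinite degree.\<close>

lemma has_degree_mono:
  assumes "subfield F CC" "has_degree E F m" "has_degree K F n" "E \<subseteq> K"
  shows "m \<le> n"
proof -
  obtain Vs where Vs: "set Vs \<subseteq> carrier CC" "CC.independent F Vs" "length Vs = m" "CC.Span F Vs = E"
    using CC.exists_base[of F m E] assms unfolding has_degree_def by blast
  have "set Vs \<subseteq> E" using CC.Span_base_incl[OF assms(1) Vs(1)] Vs(4) by simp
  thus ?thesis using CC.independent_length_le_dimension[of F n K Vs] assms Vs
    unfolding has_degree_def by auto
qed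

text \<open>Converse of \<open>quadext_has_degree\<close>: for \<open>c\<close> outside
  \<open>F\<close> the pair \<open>c\<close>, \<open>1\<close> is a basis, so \<open>c\<close>
  satisfies a quadratic equation, and completing the square gives the generator
  \<open>z = c - k / 2\<close>.\<close>

lemma has_degree_quadext:
  assumes F: "subfield F CC" and E: "subfield E CC" and deg: "has_degree E F 2"
  shows "quadext F E"
proof -
  have "F \<subseteq> E" using deg by (simp add: has_degree_def)
  moreover have "E \<noteq> F" using has_degree_unique[OF F deg, of 1] has_degree_self[OF F] by auto
  ultimately obtain c where c: "c \<in> E" "c \<notin> F" by blast
  have S1: "CC.Span F [1] = F" by (simp add: line_extension_CC)
  have "CC.independent F [c, 1]"
  proof (intro CC.li_Cons)
    show "c \<notin> CC.Span F [1]" using S1 c by simp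
  qed auto
  moreover have "set [c, 1] \<subseteq> E" using c E by (simp add: subfield_closed)
  ultimately have "CC.Span F [c, 1] = E"
    using CC.independent_length_eq_dimension[OF F, of 2 E "[c, 1]"] deg
    unfolding has_degree_def by auto
  moreover have "CC.Span F [c, 1] = {k * c + v | k v. k \<in> F \<and> v \<in> F}"
    by (subst CC.Span.simps) (use S1 in \<open>simp add: line_extension_CC[of F c]\<close>)
  ultimately have E_eq: "E = {k * c + v | k v. k \<in> F \<and> v \<in> F}" by simp
  have "c\<^sup>2 \<in> E" using c E by (simp add: subfield_closed)
  then obtain k v where kv: "k \<in> F" "v \<in> F" "c\<^sup>2 = k * c + v" using E_eq by blast
  define z where "z = c - k / 2"
  have "z\<^sup>2 = c\<^sup>2 - k * c + k\<^sup>2 / 4"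
    by (simp add: z_def algebra_simps power2_eq_square)
  hence "z\<^sup>2 = v + k\<^sup>2 / 4" using kv(3) by simp
  hence z2: "z\<^sup>2 \<in> F" using kv F by (simp add: subfield_closed)
  have "z \<notin> F"
  proof
    assume "z \<in> F"
    hence "z + k / 2 \<in> F" using kv F by (simp add: subfield_closed)
    thus False using c by (simp add: z_def)
  qed
  hence q: "quadext F (adjoin F {z})" using F z2 quadextI by blast
  have "k \<in> E" using kv(1) \<open>F \<subseteq> E\<close> by blast
  hence "z \<in> E" using c(1) E by (simp add: z_def subfield_closed)
  moreover have "E \<subseteq> adjoin F {z}"
  proof
    fix d assume "d \<in> E"
    then obtain k' v' where *: "d = k' * c + v'" "k' \<in> F" "v' \<in> F" using E_eq by blast
    have "d = (v' + k' * (k / 2)) + k' * z" by (simp add: * z_def algebra_simps)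
    moreover have "v' + k' * (k / 2) \<in> F" using * kv F by (simp add: subfield_closed)
    ultimately show "d \<in> adjoin F {z}"
      unfolding adjoin_sqrt_eq[OF F z2] using *(2) by blast
  qed
  ultimately have "E = adjoin F {z}" using adjoin_least[OF E \<open>F \<subseteq> E\<close>, of "{z}"] by auto
  thus ?thesis using q by simp
qed

subsection \<open>Iterated quadratic extensions\<close>

text \<open>\<open>z\<close> may already lie in \<open>A\<close>, so the levels of a
  \<open>sqrt_tower\<close> qualify before its steps are known to be proper.\<close>

inductive qtower :: "complex set \<Rightarrow> bool" where
  qtower_Rats: "qtower \<rat>"
| qtower_adjoin: "qtower A \<Longrightarrow> z\<^sup>2 \<in> A \<Longrightarrow> qtower (adjoin A {z})"

lemma qtower_subfield: "qtower A \<Longrightarrow> subfield A CC"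
  by (induction rule: qtower.induct) (auto simp: subfield_Rats_CC subfield_adjoin)

lemma adjoin_adjoin: "adjoin F (adjoin A S) = adjoin (adjoin F A) S"
proof (rule equalityI; rule adjoin_least)
  show "F \<subseteq> adjoin (adjoin F A) S" by (rule subset_trans[OF adjoin_incl(1) adjoin_incl(1)])
  show "S \<subseteq> adjoin F (adjoin A S)" by (rule subset_trans[OF adjoin_incl(2) adjoin_incl(2)])
  show "adjoin A S \<subseteq> adjoin (adjoin F A) S"
    by (rule adjoin_least[OF subfield_adjoin subset_trans[OF adjoin_incl(2) adjoin_incl(1)]
          adjoin_incl(2)])
  show "adjoin F A \<subseteq> adjoin F (adjoin A S)"
    by (rule adjoin_least[OF subfield_adjoin adjoin_incl(1) subset_trans[OF adjoin_incl(1)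
          adjoin_incl(2)]])
qed (auto simp: subfield_adjoin adjoin_incl)

lemma adjoin_qtower_quadext:
  assumes "qtower A" "subfield F CC" "adjoin F A \<noteq> F"
  shows "\<exists>E. F \<subseteq> E \<and> quadext E (adjoin F A)"
  using assms
proof (induction rule: qtower.induct)
  case qtower_Rats
  thus ?case using adjoin_absorb[of F \<rat>] Rats_subset[of F] by auto
next
  case (qtower_adjoin A z)
  let ?B = "adjoin F A"
  have eq: "adjoin F (adjoin A {z}) = adjoin ?B {z}" by (rule adjoin_adjoin)
  have B: "subfield ?B CC" by (rule subfield_adjoin)
  show ?case
  proof (cases "z \<in> ?B")
    case True
    hence "adjoin ?B {z} = ?B" using adjoin_absorb[OF B] by simp
    thus ?thesis using qtower_adjoin eq by simp
  next
    case False
    have "z\<^sup>2 \<in> ?B" using qtower_adjoin.hyps adjoin_incl(2)[of A F] by blast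
    hence "quadext ?B (adjoin ?B {z})" using quadextI[OF B _ False] by blast
    thus ?thesis unfolding eq using adjoin_incl(1)[of F A] by blast
  qed
qed

text \<open>Adjoining the successive square roots of \<open>T\<close> to \<open>F\<close>, the last step that is not trivial is a
  quadratic extension with top field \<open>T\<close>.\<close>

lemma qtower_maximal_subfield:
  assumes "qtower T" "subfield F CC" "F \<subset> T"
  obtains E where "F \<subseteq> E" "quadext E T"
proof -
  have "adjoin F T = T"
    using adjoin_least[OF qtower_subfield[OF assms(1)], of F T] assms(3) adjoin_incl(2)[of T F] by auto
  thus ?thesis using that adjoin_qtower_quadext[OF assms(1,2)] assms(3) by auto
qed

lemma subfield_directed_Union:
  assumes mono: "\<And>m n. m \<le> n \<Longrightarrow> K m \<subseteq> K (n::nat)" and K: "\<And>n. subfield (K n) CC"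
  shows "subfield (\<Union>n. K n) CC"
proof (rule subfieldI_CC)
  fix a b assume "a \<in> (\<Union>n. K n)" "b \<in> (\<Union>n. K n)"
  then obtain m n where "a \<in> K m" "b \<in> K n" by blast
  hence "a \<in> K (max m n)" "b \<in> K (max m n)" using mono[of m "max m n"] mono[of n "max m n"] by auto
  hence "a + b \<in> K (max m n)" "a * b \<in> K (max m n)"
    using subfield_add[OF K] subfield_mult[OF K] by simp_all
  thus "a + b \<in> (\<Union>n. K n)" "a * b \<in> (\<Union>n. K n)" by blast+
next
  show "1 \<in> (\<Union>n. K n)" using subfield_1[OF K] by (rule UN_I[OF UNIV_I])
next
  fix a assume "a \<in> (\<Union>n. K n)"
  then obtain n where "a \<in> K n" by blast
  hence "- a \<in> K n" "inverse a \<in> K n" using subfield_uminus[OF K] subfield_inverse[OF K] by simp_all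
  thus "- a \<in> (\<Union>n. K n)" "inverse a \<in> (\<Union>n. K n)" by blast+
qed

text \<open>If \<open>F\<close> does not contain \<open>K m\<close>, then \<open>F\<close> meets
  every higher level in a proper subfield, which lies in one of index two and hence, by
  \<open>max\<close>, one level lower. Descending, all of \<open>F\<close> lands in
  \<open>K m\<close>. The bound \<open>N\<close> leaves room for low levels with further index-two
  subfields.\<close>

lemma proper_subfield_of_qtower_Union:
  assumes mono: "\<And>m n. m \<le> n \<Longrightarrow> K m \<subseteq> K (n::nat)" and K: "\<And>n. qtower (K n)"
    and max: "\<And>n E. n \<ge> N \<Longrightarrow> quadext E (K (Suc n)) \<Longrightarrow> E \<subseteq> K n"
    and F: "subfield F CC" "F \<subset> (\<Union>n. K n)"
  shows "\<exists>n. F \<subseteq> K n"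
proof -
  obtain m' where "\<not> K m' \<subseteq> F" using psubset_imp_ex_mem[OF F(2)] by blast
  \<comment> \<open>The shift by \<open>N\<close> lets \<open>max\<close> apply at every level from
    \<open>m\<close> on.\<close>
  define m where "m = m' + N"
  have m: "\<not> K m \<subseteq> F" "m \<ge> N"
    using \<open>\<not> K m' \<subseteq> F\<close> mono[of m' "m' + N"] by (auto simp: m_def)
  have sub: "F \<inter> K (m + i) \<subseteq> K m" for i
  proof (induction i)
    case (Suc i)
    let ?G = "F \<inter> K (m + Suc i)"
    have G: "subfield ?G CC" by (rule subfield_Int[OF F(1) qtower_subfield[OF K]])
    have "?G \<noteq> K (m + Suc i)"
    proof
      assume "?G = K (m + Suc i)"
      hence "K (m + Suc i) \<subseteq> F" by blast
      moreover have "K m \<subseteq> K (m + Suc i)" by (rule mono) simp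
      ultimately show False using m(1) by blast
    qed
    hence "?G \<subset> K (m + Suc i)" by blast
    with G obtain E where E: "?G \<subseteq> E" "quadext E (K (m + Suc i))"
      by (rule qtower_maximal_subfield[OF K])
    have "E \<subseteq> K (m + i)" using max[of "m + i" E] m(2) E(2) by simp
    thus ?case using E(1) Suc.IH by blast
  qed simp
  have "F \<subseteq> K m"
  proof
    fix a assume a: "a \<in> F"
    obtain i where "a \<in> K i" using psubsetD[OF F(2) a] by blast
    moreover have "K i \<subseteq> K (m + i)" by (rule mono) simp
    ultimately show "a \<in> K m" using sub[of i] a by blast
  qed
  thus ?thesis by blast
qed

section \<open>Towers of iterated square roots\<close>

text \<open>Only the squares are prescribed, so all sign choices are covered, and so is the tower of
  triple-angle images \<open>z\<close> below.\<close>

locale sqrt_tower =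
  fixes \<nu> x0 :: int and x :: "nat \<Rightarrow> complex"
  assumes x_0: "x 0 = of_int x0" and x_Suc: "(x (Suc n))\<^sup>2 = of_int \<nu> + x n"
begin

definition K :: "nat \<Rightarrow> complex set" where "K n = adjoin \<rat> {x n}"

lemma K_0: "K 0 = \<rat>"
  unfolding K_def x_0 by (rule adjoin_absorb[OF subfield_Rats_CC]) simp

lemma subfield_K: "subfield (K n) CC"
  unfolding K_def by (rule subfield_adjoin)

lemma x_mem_K: "x n \<in> K n"
  unfolding K_def by (rule adjoin_mem)

lemma K_least: "subfield F CC \<Longrightarrow> x n \<in> F \<Longrightarrow> K n \<subseteq> F"
  unfolding K_def by (rule adjoin_least) (auto simp: Rats_subset)

lemma K_Suc_mono: "K n \<subseteq> K (Suc n)"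
proof (rule K_least[OF subfield_K])
  have "x n = (x (Suc n))\<^sup>2 - of_int \<nu>" by (simp add: x_Suc)
  thus "x n \<in> K (Suc n)" using subfield_K[of "Suc n"] x_mem_K[of "Suc n"] by (simp add: subfield_closed)
qed

lemma K_mono: "m \<le> n \<Longrightarrow> K m \<subseteq> K n"
  by (rule lift_Suc_mono_le[of K, OF K_Suc_mono])

lemma x_mem_K': "m \<le> n \<Longrightarrow> x m \<in> K n"
  using K_mono x_mem_K by blast

lemma x_Suc_square_mem: "(x (Suc n))\<^sup>2 \<in> K n"
  using x_mem_K[of n] subfield_K[of n] by (simp add: x_Suc subfield_closed)

lemma K_Suc: "K (Suc n) = adjoin (K n) {x (Suc n)}"
proof (intro equalityI)
  show "K (Suc n) \<subseteq> adjoin (K n) {x (Suc n)}" by (intro K_least subfield_adjoin adjoin_mem)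
  show "adjoin (K n) {x (Suc n)} \<subseteq> K (Suc n)"
    by (rule adjoin_least[OF subfield_K K_Suc_mono]) (simp add: x_mem_K)
qed

lemma qtower_K: "qtower (K n)"
  by (induction n) (auto simp: K_0 K_Suc qtower_Rats intro!: qtower_adjoin x_Suc_square_mem)

lemma K_Suc_quadext: "x (Suc n) \<notin> K n \<Longrightarrow> quadext (K n) (K (Suc n))"
  unfolding K_Suc by (rule quadextI[OF subfield_K x_Suc_square_mem])

text \<open>Taking norms down the tower turns \<open>u\<^sub>i - x\<^sub>j\<close> into \<open>u\<^sub>i\<^sup>2 - x\<^sub>j\<^sup>2 = u\<^sub>i\<^sub>+\<^sub>1 - x\<^sub>j\<^sub>-\<^sub>1\<close>.\<close>

lemma u_minus_x_square_imp:
  assumes "\<And>i. i < j \<Longrightarrow> x (Suc i) \<notin> K i" "c \<in> K j" "c\<^sup>2 = of_int (u \<nu> i) - x j"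
  shows "\<exists>a::int. u \<nu> (i + j) - x0 = a\<^sup>2"
  using assms
proof (induction j arbitrary: i c)
  case 0
  thus ?case using of_int_square_in_RatsD[of c "u \<nu> i - x0"] by (auto simp: K_0 x_0)
next
  case (Suc j)
  have "\<exists>d\<in>K j. d\<^sup>2 = (of_int (u \<nu> i))\<^sup>2 - (-1)\<^sup>2 * (x (Suc j))\<^sup>2"
    using Suc.prems subfield_K[of j]
    by (intro quadext_norm_square[where c = c] x_Suc_square_mem)
       (auto simp: K_Suc subfield_closed)
  then obtain d where "d \<in> K j" "d\<^sup>2 = of_int (u \<nu> (Suc i)) - x j"
    by (auto simp: x_Suc)
  from Suc.IH[OF _ this] Suc.prems(1) show ?case by auto
qed

text \<open>A root of \<open>\<nu> + x (Suc m)\<close> in \<open>K (Suc m)\<close> has as norm a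
  root of \<open>\<nu>\<^sup>2 - (x (Suc m))\<^sup>2 = u \<nu> 0 - x m\<close> in
  \<open>K m\<close>, and further norms make \<open>u \<nu> m - x0\<close> a square.\<close>

lemma step_SucI:
  assumes step: "\<And>i. i \<le> m \<Longrightarrow> x (Suc i) \<notin> K i" and ns: "\<And>a::int. u \<nu> m - x0 \<noteq> a\<^sup>2"
  shows "x (Suc (Suc m)) \<notin> K (Suc m)"
proof
  assume y: "x (Suc (Suc m)) \<in> K (Suc m)"
  have "(x (Suc (Suc m)))\<^sup>2 = of_int \<nu> + 1 * x (Suc m)" using x_Suc[of "Suc m"] by simp
  then obtain d where "d \<in> K m" "d\<^sup>2 = (of_int \<nu>)\<^sup>2 - 1\<^sup>2 * (x (Suc m))\<^sup>2"
    using quadext_norm_square[OF subfield_K x_Suc_square_mem step[OF order_refl],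
        of "x (Suc (Suc m))" "of_int \<nu>" 1] y K_Suc subfield_of_int[OF subfield_K]
      subfield_1[OF subfield_K] by auto
  hence "d \<in> K m" "d\<^sup>2 = of_int (u \<nu> 0) - x m" by (auto simp: x_Suc)
  from u_minus_x_square_imp[OF _ this] step ns show False by auto
qed

text \<open>Otherwise \<open>b = c * x (Suc (Suc k))\<close> with \<open>c\<close> in
  \<open>K (Suc k)\<close>, so \<open>b\<^sup>2 * (\<nu> + x (Suc k))\<close> is a square in
  \<open>K (Suc k)\<close>. Taking its norm and dividing by \<open>b\<^sup>2\<close> yields a root
  of \<open>u \<nu> 0 - x k\<close> in \<open>K k\<close>.\<close>

lemma square_descends:
  assumes ns: "\<And>c. c \<in> K k \<Longrightarrow> c\<^sup>2 \<noteq> of_int (u \<nu> 0) - x k"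
    and step: "x (Suc k) \<notin> K k" "x (Suc (Suc k)) \<notin> K (Suc k)"
    and b: "b \<in> K (Suc (Suc k))" "b\<^sup>2 \<in> K k"
  shows "b \<in> K (Suc k)"
proof (rule ccontr)
  assume nb: "b \<notin> K (Suc k)"
  have b2: "b\<^sup>2 \<in> K (Suc k)" using b(2) K_Suc_mono by blast
  obtain c where c: "c \<in> K (Suc k)" "b = c * x (Suc (Suc k))"
    using adjoin_sqrt_square[OF subfield_K x_Suc_square_mem step(2) _ b2 nb] b(1) K_Suc by metis
  have "b \<noteq> 0" using nb subfield_0[OF subfield_K] by auto
  hence "c \<noteq> 0" using c by auto
  \<comment> \<open>This is \<open>b * x (Suc (Suc k))\<close>, written so that its membership in
    \<open>K (Suc k)\<close> is visible.\<close>
  define c' where "c' = b\<^sup>2 / c"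
  have c': "c' \<in> adjoin (K k) {x (Suc k)}"
    using b2 c(1) subfield_K by (simp add: c'_def K_Suc[symmetric] subfield_closed)
  have "c'\<^sup>2 = (b\<^sup>2 * b\<^sup>2) / c\<^sup>2" by (simp add: c'_def power2_eq_square)
  also have "\<dots> = b\<^sup>2 * (c\<^sup>2 * (of_int \<nu> + x (Suc k))) / c\<^sup>2"
    using c(2) x_Suc[of "Suc k"] by (metis power_mult_distrib)
  also have "\<dots> = b\<^sup>2 * of_int \<nu> + b\<^sup>2 * x (Suc k)" using \<open>c \<noteq> 0\<close> by (simp add: distrib_left)
  finally obtain d where d: "d \<in> K k" "d\<^sup>2 = (b\<^sup>2 * of_int \<nu>)\<^sup>2 - (b\<^sup>2)\<^sup>2 * (x (Suc k))\<^sup>2"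
    using quadext_norm_square[OF subfield_K x_Suc_square_mem step(1) c', of "b\<^sup>2 * of_int \<nu>" "b\<^sup>2"]
      b(2) subfield_K[of k] by (auto simp: subfield_closed)
  have "(d / b\<^sup>2)\<^sup>2 = d\<^sup>2 / (b\<^sup>2)\<^sup>2" by (simp add: power_divide)
  also have "\<dots> = (of_int \<nu>)\<^sup>2 - (x (Suc k))\<^sup>2"
    using \<open>b \<noteq> 0\<close> by (simp only: d power_mult_distrib) (simp add: field_simps)
  also have "\<dots> = of_int (u \<nu> 0) - x k" by (simp add: x_Suc)
  finally have "(d / b\<^sup>2)\<^sup>2 = of_int (u \<nu> 0) - x k" .
  moreover have "d / b\<^sup>2 \<in> K k" using d(1) b(2) subfield_K by (simp add: subfield_divide)
  ultimately show False using ns by blast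
qed

end

section \<open>Towers with proper steps and the involutions of their levels\<close>

locale proper_sqrt_tower = sqrt_tower +
  assumes step: "x (Suc n) \<notin> K n"
begin

lemma quadext_K: "quadext (K n) (K (Suc n))"
  by (rule K_Suc_quadext[OF step])

lemma x_nonzero: "x (Suc n) \<noteq> 0"
  using step[of n] subfield_0[OF subfield_K, of n] by metis

lemma K_strict_mono: "m < n \<Longrightarrow> K m \<subset> K n"
  by (rule lift_Suc_mono_less[of K, OF quadext_psubset[OF quadext_K]])

lemma has_degree_K: "has_degree (K n) \<rat> (2 ^ n)"
proof (induction n)
  case 0
  show ?case using has_degree_self[OF subfield_Rats_CC] by (simp add: K_0)
next
  case (Suc n)
  thus ?case using has_degree_quadext_step[OF subfield_Rats_CC Suc.IH quadext_K] by simp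
qed

lemma K_psubset_Union: "K n \<subset> (\<Union>n. K n)"
  using step[of n] x_mem_K[of "Suc n"] by blast

text \<open>Iterates \<open>square_descends\<close>: as long as \<open>b\<close> is above level
  \<open>Suc j\<close>, its square lies at least two levels below.\<close>

lemma square_descends_to:
  assumes ns: "\<And>k c. k \<ge> j \<Longrightarrow> c \<in> K k \<Longrightarrow> c\<^sup>2 \<noteq> of_int (u \<nu> 0) - x k"
    and b: "b \<in> K n" "b\<^sup>2 \<in> K j"
  shows "b \<in> K (Suc j)"
  using b(1)
proof (induction n)
  case 0
  thus ?case using K_mono[of 0 "Suc j"] by blast
next
  case (Suc n)
  show ?case
  proof (cases "n \<le> j")
    case True
    thus ?thesis using Suc.prems K_mono[of "Suc n" "Suc j"] by blast
  next
    case False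
    then obtain k where k: "n = Suc k" "j \<le> k" by (cases n) auto
    have "b\<^sup>2 \<in> K k" using b(2) K_mono[OF k(2)] by blast
    hence "b \<in> K (Suc k)" using square_descends[of k b] ns[OF k(2)] step Suc.prems k(1) by blast
    thus ?thesis using Suc.IH k(1) by simp
  qed
qed

lemma involution_cases:
  assumes ns: "\<forall>k\<ge>1. \<forall>c\<in>K k. c\<^sup>2 \<noteq> of_int (u \<nu> 0) - x k"
    and \<tau>: "involution_on (K n) \<tau>" "fixed_field (K n) \<tau> \<noteq> K n"
  obtains (bottom) m where "n = Suc m" "fixed_field (K n) \<tau> = K m"
  | (exceptional) c :: complex where "c \<in> \<rat>" "c\<^sup>2 = of_int (u \<nu> 0 - x0)" "n \<ge> 2" "\<tau> (x 1) = - x 1"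
proof -
  let ?F = "fixed_field (K n) \<tau>"
  have F: "subfield ?F CC" by (rule subfield_fixed_field[OF \<tau>(1)])
  have "x n \<notin> ?F" using K_least[OF F] \<tau>(2) by (auto simp: fixed_field_def)
  hence ex: "\<exists>k. x k \<notin> ?F" by blast
  \<comment> \<open>The first generator moved by \<open>\<tau>\<close>. With
    \<open>k = Suc i\<close> all of \<open>K i\<close> is fixed, so \<open>\<tau>\<close> negates
    \<open>x k\<close>.\<close>
  define k where "k = (LEAST k. x k \<notin> ?F)"
  have k: "x k \<notin> ?F" unfolding k_def by (rule LeastI_ex[OF ex])
  have k_le: "k \<le> n" unfolding k_def by (rule Least_le) fact
  have "k \<noteq> 0" using k subfield_of_int[OF F] by (metis x_0)
  then obtain i where i: "k = Suc i" by (cases k) auto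
  have xi: "x i \<in> ?F" using not_less_Least[of i "\<lambda>k. x k \<notin> ?F"] i by (simp add: k_def)
  have Ki: "K i \<subseteq> ?F" by (rule K_least[OF F xi])
  have xk: "x k \<in> K n" by (rule x_mem_K'[OF k_le])
  have "\<tau> ((x k)\<^sup>2) = (x k)\<^sup>2" using Ki x_Suc_square_mem[of i] by (auto simp: i fixed_field_def)
  hence \<tau>k: "\<tau> (x k) = - x k"
    using involution_sqrt[OF \<tau>(1) xk] k xk by (auto simp: fixed_field_def)
  show ?thesis
  proof (cases "k = n")
    case True
    have "?F \<subset> adjoin (K i) {x (Suc i)}" using \<tau>(2) True i K_Suc by (auto simp: fixed_field_def)
    hence "?F = K i" using quadext_between[OF subfield_K x_Suc_square_mem F Ki] by blast
    thus ?thesis using bottom True i by blast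
  next
    case False
    hence kn: "Suc k \<le> n" using k_le by simp
    \<comment> \<open>The product of \<open>x (Suc k)\<close> with its image is fixed by
      \<open>\<tau>\<close>, and its square is
      \<open>\<nu>\<^sup>2 - (x k)\<^sup>2 = u \<nu> 0 - x i\<close>.\<close>
    define b where "b = x (Suc k) * \<tau> (x (Suc k))"
    have y: "x (Suc k) \<in> K n" by (rule x_mem_K'[OF kn])
    have b_mem: "b \<in> K n" using y by (simp add: b_def subfield_mult subfield_K involution_mem[OF \<tau>(1)])
    have b_fixed: "\<tau> b = b"
      using y by (simp add: b_def involution_mult[OF \<tau>(1)] involution_invol[OF \<tau>(1)]
          involution_mem[OF \<tau>(1)] mult.commute)
    have "(\<tau> (x (Suc k)))\<^sup>2 = \<tau> (of_int \<nu> + x k)"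
      using involution_power[OF \<tau>(1) y, of 2] x_Suc by simp
    also have "\<dots> = of_int \<nu> - x k"
      using xk \<tau>k by (simp add: involution_add[OF \<tau>(1)] involution_of_int[OF \<tau>(1)]
          subfield_of_int[OF subfield_K])
    finally have "b\<^sup>2 = (of_int \<nu> + x k) * (of_int \<nu> - x k)"
      by (simp add: b_def power_mult_distrib x_Suc)
    also have "\<dots> = (of_int \<nu>)\<^sup>2 - (x k)\<^sup>2" by (simp add: algebra_simps power2_eq_square)
    finally have b2: "b\<^sup>2 = of_int (u \<nu> 0) - x i" by (simp add: i x_Suc)
    have b2_mem: "b\<^sup>2 \<in> K i"
      unfolding b2 using subfield_K[of i] x_mem_K[of i] subfield_diff subfield_of_int by blast
    \<comment> \<open>Without such roots from level \<open>i\<close> on, \<open>b\<close> descends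
      to \<open>K (Suc i)\<close>. Not lying in \<open>K i\<close>, it is a multiple of
      \<open>x k\<close> by a fixed element, so \<open>\<tau>\<close> both negates and fixes
      it.\<close>
    have no: False if ns': "\<And>k c. k \<ge> i \<Longrightarrow> c \<in> K k \<Longrightarrow> c\<^sup>2 \<noteq> of_int (u \<nu> 0) - x k"
    proof -
      have nb: "b \<notin> K i" using ns'[of i b] b2 by auto
      have "b \<in> K (Suc i)" using square_descends_to[OF ns' b_mem b2_mem] by blast
      then obtain c where c: "c \<in> K i" "b = c * x k"
        using adjoin_sqrt_square[OF subfield_K x_Suc_square_mem step _ b2_mem nb] K_Suc i by metis
      have "\<tau> c = c" "c \<in> K n" using c(1) Ki by (auto simp: fixed_field_def)
      hence "\<tau> b = - b" using c(2) xk \<tau>k by (simp add: involution_mult[OF \<tau>(1)])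
      hence "b = 0" using b_fixed by simp
      thus False using nb subfield_0[OF subfield_K] by simp
    qed
    \<comment> \<open>For \<open>i \<ge> 1\<close> the hypothesis \<open>ns\<close> covers all
      levels from \<open>i\<close> on.\<close>
    have i0: "i = 0" by (rule ccontr) (use no ns in force)
    have "\<exists>c\<in>K 0. c\<^sup>2 = of_int (u \<nu> 0) - x 0"
    proof (rule ccontr)
      assume "\<not> (\<exists>c\<in>K 0. c\<^sup>2 = of_int (u \<nu> 0) - x 0)"
      hence "c\<^sup>2 \<noteq> of_int (u \<nu> 0) - x k" if "c \<in> K k" for k c
        using ns that by (cases "k = 0") auto
      thus False using no by blast
    qed
    thus ?thesis using exceptional \<tau>k kn i i0 by (auto simp: K_0 x_0)
  qed
qed

end

section \<open>Towers where \<open>u \<nu> j - x0\<close> can be a square only for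
  \<open>j = 0\<close>\<close>

locale rigid_sqrt_tower = proper_sqrt_tower +
  assumes u_not_square: "j \<ge> 1 \<Longrightarrow> u \<nu> j - x0 \<noteq> (a::int)\<^sup>2"
begin

lemma u_minus_x_not_square: "\<forall>k\<ge>1. \<forall>c\<in>K k. c\<^sup>2 \<noteq> of_int (u \<nu> 0) - x k"
  using u_minus_x_square_imp[of _ _ 0] step u_not_square by fastforce

lemma Rats_in_range_K: "\<rat> \<in> range K"
  using K_0 by (metis rangeI)

lemma proper_subfields_nonsquare:
  assumes "\<nexists>a::int. u \<nu> 0 - x0 = a\<^sup>2"
  shows "proper_subfields_of (\<Union>n. K n) = range K"
proof (intro equalityI subsetI)
  \<comment> \<open>In the exceptional case the rational root \<open>c\<close> would be an integer
    with square \<open>u \<nu> 0 - x0\<close>, so only the bottom case survives.\<close>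
  have max: "\<exists>m. n = Suc m \<and> E = K m" if "quadext E (K n)" for E n
  proof -
    obtain \<tau> where \<tau>: "involution_on (K n) \<tau>" "fixed_field (K n) \<tau> = E"
      using quadext_involution[OF \<open>quadext E (K n)\<close>] .
    have ne: "fixed_field (K n) \<tau> \<noteq> K n"
      using \<tau>(2) quadext_psubset[OF \<open>quadext E (K n)\<close>] by blast
    show ?thesis
    proof (cases rule: involution_cases[OF u_minus_x_not_square \<tau>(1) ne,
          case_names bottom exceptional])
      case (bottom m)
      thus ?thesis using \<tau>(2) by blast
    next
      case (exceptional c)
      thus ?thesis using of_int_square_in_RatsD[of c "u \<nu> 0 - x0"] assms by blast
    qed
  qed
  have fin: "F \<in> range K" if "subfield F CC" "F \<subseteq> K n" for F n
    using that
  proof (induction n)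
    case 0
    hence "F = \<rat>" using Rats_subset[of F] K_0 by auto
    thus ?case using Rats_in_range_K by simp
  next
    case (Suc n)
    show ?case
    proof (cases "F = K (Suc n)")
      case False
      then obtain E where E: "F \<subseteq> E" "quadext E (K (Suc n))"
        using qtower_maximal_subfield[OF qtower_K Suc.prems(1)] Suc.prems(2) by blast
      thus ?thesis using Suc max[OF E(2)] by auto
    qed auto
  qed
  fix F assume "F \<in> proper_subfields_of (\<Union>n. K n)"
  hence F: "subfield F CC" "F \<subset> (\<Union>n. K n)" by (auto simp: proper_subfields_of_def)
  have "\<exists>n. F \<subseteq> K n"
    by (rule proper_subfield_of_qtower_Union[OF K_mono qtower_K _ F, of 0]) (use max in auto)
  thus "F \<in> range K" using fin F(1) by blast
next
  fix F assume "F \<in> range K"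
  then obtain n where "F = K n" by blast
  thus "F \<in> proper_subfields_of (\<Union>n. K n)"
    unfolding proper_subfields_of_def using subfield_K[of n] K_psubset_Union[of n] by blast
qed

end

section \<open>The square case and its two extra quadratic fields\<close>

locale square_sqrt_tower = rigid_sqrt_tower +
  fixes a :: int
  assumes a_square: "u \<nu> 0 - x0 = a\<^sup>2" and pos: "\<nu> + x0 > 0"
begin

text \<open>For \<open>b = a\<close> and \<open>b = - a\<close> this is the trace of
  \<open>x 2\<close> under an involution sending \<open>x 2\<close> to \<open>b / x 2\<close>, and a
  square root of \<open>2 * (\<nu> + b)\<close>. The parameter \<open>b\<close> treats both signs at
  once.\<close>

definition w :: "int \<Rightarrow> complex" where "w b = x 2 + of_int b / x 2"

definition W :: "int \<Rightarrow> complex set" where "W b = adjoin \<rat> {w b}"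

lemma x2: "x 2 \<noteq> 0" "x 2 \<notin> K 1" "(x 2)\<^sup>2 = of_int \<nu> + x 1"
  using x_nonzero[of 1] step[of 1] x_Suc[of 1] by (auto simp: numeral_2_eq_2)

lemma x1: "x 1 \<notin> \<rat>" "(x 1)\<^sup>2 = of_int (\<nu> + x0)"
  using step[of 0] x_Suc[of 0] by (auto simp: K_0 x_0)

context
  fixes b :: int
  assumes b: "b\<^sup>2 = a\<^sup>2"
begin

lemma b_square: "(of_int b)\<^sup>2 = (of_int \<nu> + x 1) * (of_int \<nu> - x 1)"
proof -
  have "b\<^sup>2 = \<nu>\<^sup>2 - (\<nu> + x0)" using a_square b by simp
  hence "(of_int b :: complex)\<^sup>2 = (of_int \<nu>)\<^sup>2 - (x 1)\<^sup>2"
    unfolding x1(2) by (metis of_int_diff of_int_power)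
  thus ?thesis by (simp add: algebra_simps power2_eq_square)
qed

lemma b_square_div: "(of_int b)\<^sup>2 / (x 2)\<^sup>2 = of_int \<nu> - x 1"
  using b_square x2(1) x2(3)[symmetric] by simp

lemma w_square: "(w b)\<^sup>2 = of_int (2 * (\<nu> + b))"
proof -
  have "(w b)\<^sup>2 = (x 2)\<^sup>2 + 2 * of_int b + (of_int b)\<^sup>2 / (x 2)\<^sup>2"
    using x2(1) by (simp add: w_def power2_sum power_divide)
  thus ?thesis using b_square_div x2(3) by simp
qed

lemma w_mult: "w b * w (- b) = 2 * x 1"
proof -
  have "w b * w (- b) = (x 2)\<^sup>2 - (of_int b)\<^sup>2 / (x 2)\<^sup>2"
    by (simp add: w_def algebra_simps power2_eq_square)
  thus ?thesis using b_square_div x2(3) by simp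
qed

lemma w_add: "w b + w (- b) = 2 * x 2"
  by (simp add: w_def)

text \<open>If \<open>w b\<close> vanished, then \<open>b = - \<nu>\<close> and so
  \<open>\<nu> + x0 = 0\<close>, which \<open>pos\<close> excludes.\<close>

lemma w_nonzero: "w b \<noteq> 0"
proof
  assume "w b = 0"
  hence "of_int (2 * (\<nu> + b)) = (0 :: complex)" using w_square by simp
  hence "\<nu> + b = 0" by (simp only: of_int_eq_0_iff mult_eq_0_iff) simp
  hence "b = - \<nu>" by simp
  thus False using a_square b pos by simp
qed

text \<open>Obtained from the product and the sum of \<open>w b\<close> and \<open>w (- b)\<close>.
  It shows that \<open>w b\<close> is outside \<open>K 1\<close> and that \<open>w b\<close> and
  \<open>x 1\<close> generate \<open>K 2\<close>.\<close>

lemma x2_eq: "x 2 = (w b + 2 * x 1 / w b) / 2"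
proof -
  have "w (- b) = 2 * x 1 / w b" using w_mult w_nonzero by (simp add: eq_divide_eq mult.commute)
  hence "w b + 2 * x 1 / w b = 2 * x 2" using w_add by (simp only:)
  thus ?thesis by (simp only: nonzero_mult_div_cancel_left[OF zero_neq_numeral[symmetric]])
qed

lemma w_notin_K1: "w b \<notin> K 1"
proof
  assume "w b \<in> K 1"
  hence "(w b + 2 * x 1 / w b) / 2 \<in> K 1" using x_mem_K[of 1] by (intro subfield_closed subfield_K)
  thus False using x2(2) by (simp only: x2_eq[symmetric])
qed

lemma w_notin_Rats: "w b \<notin> \<rat>"
  using w_notin_K1 K_mono[of 0 1] by (auto simp: K_0)

lemma w_square_Rats: "(w b)\<^sup>2 \<in> \<rat>"
  by (simp add: w_square)

lemma quadext_W: "quadext \<rat> (W b)"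
  unfolding W_def by (rule quadextI[OF subfield_Rats_CC w_square_Rats w_notin_Rats])

lemma subfield_W: "subfield (W b) CC"
  unfolding W_def by (rule subfield_adjoin)

lemma w_mem_K2: "w b \<in> K 2"
  using x_mem_K[of 2] subfield_K[of 2] by (simp add: w_def subfield_closed)

lemma W_subset_K2: "W b \<subseteq> K 2"
  unfolding W_def using w_mem_K2 subfield_K by (intro adjoin_least) (auto simp: Rats_subset)

text \<open>An inclusion of \<open>K 1\<close> in the quadratic field \<open>W b\<close> would be an
  equality and put \<open>w b\<close> into \<open>K 1\<close>.\<close>

lemma x1_notin_W: "x 1 \<notin> W b"
proof
  assume "x 1 \<in> W b"
  hence "K 1 \<subseteq> W b" using K_least[OF subfield_W] by blast
  hence "K 1 = \<rat> \<or> K 1 = W b"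
    using quadext_between_cases[OF quadext_W subfield_K] Rats_subset[OF subfield_K] by blast
  thus False using x1(1) x_mem_K[of 1] w_notin_K1 adjoin_mem[of "w b" \<rat>] by (auto simp: W_def)
qed

lemma x1_square_W: "(x 1)\<^sup>2 \<in> W b"
  unfolding x1(2) by (rule subfield_of_int[OF subfield_W])

lemma K2_eq: "K 2 = adjoin (W b) {x 1}"
proof (rule equalityI)
  have *: "w b \<in> adjoin (W b) {x 1}"
    using adjoin_incl(1)[of "W b" "{x 1}"] adjoin_mem[of "w b" \<rat>] by (auto simp: W_def)
  have "x 2 \<in> adjoin (W b) {x 1}"
    by (subst x2_eq) (intro subfield_closed subfield_adjoin * adjoin_mem)
  thus "K 2 \<subseteq> adjoin (W b) {x 1}" by (rule K_least[OF subfield_adjoin])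
  show "adjoin (W b) {x 1} \<subseteq> K 2"
    using W_subset_K2 x_mem_K'[of 1 2] by (intro adjoin_least subfield_K) auto
qed

lemma W_notin_range: "W b \<notin> range K"
proof
  assume "W b \<in> range K"
  then obtain n where n: "W b = K n" by blast
  have "n = 0" using n x1_notin_W x_mem_K'[of 1 n] by (cases n) auto
  thus False using n K_0 quadext_psubset[OF quadext_W] by simp
qed

lemma W_eq_sqrtC: "W b = adjoin \<rat> {sqrtC (2 * (\<nu> + b))}"
  unfolding W_def by (rule adjoin_sqrt_cong) (simp only: w_square sqrtC_def power2_csqrt)

text \<open>Suppose \<open>n \<ge> 3\<close>. The product \<open>d\<close> of \<open>x 3\<close>
  with its image has square \<open>\<nu>\<^sup>2 + b + \<nu> * w b\<close>. It descends to
  \<open>K 3\<close>, then to \<open>K 2\<close>, and being fixed it lies in \<open>W b\<close>; its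
  norm to the rationals makes \<open>u \<nu> 1 - x0\<close> a square.\<close>

lemma exceptional_only_K2:
  assumes \<tau>: "involution_on (K n) \<tau>" "n \<ge> 2" "\<tau> (x 1) = - x 1" "x 2 * \<tau> (x 2) = of_int b"
  shows "n = 2 \<and> fixed_field (K n) \<tau> = W b"
proof -
  let ?F = "fixed_field (K n) \<tau>"
  note inv = involution_add[OF \<tau>(1)] involution_mult[OF \<tau>(1)] involution_mem[OF \<tau>(1)]
    involution_invol[OF \<tau>(1)] involution_of_int[OF \<tau>(1)]
  have F: "subfield ?F CC" by (rule subfield_fixed_field[OF \<tau>(1)])
  have x2n: "x 2 \<in> K n" and x1n: "x 1 \<in> K n" using \<tau>(2) x_mem_K' by auto
  have \<tau>2: "\<tau> (x 2) = of_int b / x 2" using \<tau>(4) x2(1) by (simp add: eq_divide_eq mult.commute)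
  have "w b = x 2 + \<tau> (x 2)" by (simp add: w_def \<tau>2)
  hence "w b \<in> ?F" using x2n by (simp add: fixed_field_def inv subfield_add[OF subfield_K])
  hence WF: "W b \<subseteq> ?F" unfolding W_def using F by (intro adjoin_least) (auto simp: Rats_subset)
  have x1F: "x 1 \<notin> ?F" using \<tau>(3) x_nonzero[of 0] by (simp add: fixed_field_def)
  \<comment> \<open>The fixed part of \<open>K 2\<close> contains \<open>W b\<close> and omits
    \<open>x 1\<close>, which generates \<open>K 2\<close> over \<open>W b\<close> as a square
    root.\<close>
  have FK2: "?F \<inter> K 2 = W b"
    by (rule quadext_between[OF subfield_W x1_square_W subfield_Int[OF F subfield_K]])
       (use WF W_subset_K2 x1F x_mem_K'[of 1 2] K2_eq in auto)
  have "n = 2"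
  proof (rule ccontr)
    assume "n \<noteq> 2"
    hence n3: "3 \<le> n" using \<tau>(2) by simp
    have x3: "(x 3)\<^sup>2 = of_int \<nu> + x 2" "x 3 \<notin> K 2" "x 3 \<noteq> 0" "K 3 = adjoin (K 2) {x 3}"
      "(x 3)\<^sup>2 \<in> K 2"
      using x_Suc[of 2] step[of 2] x_nonzero[of 2] K_Suc[of 2] x_Suc_square_mem[of 2]
      by (auto simp: numeral_3_eq_3)
    have x3n: "x 3 \<in> K n" by (rule x_mem_K'[OF n3])
    define d where "d = x 3 * \<tau> (x 3)"
    have d_mem: "d \<in> K n" and d_fix: "\<tau> d = d"
      using x3n by (auto simp: d_def inv subfield_mult[OF subfield_K] mult.commute)
    have "d\<^sup>2 = (x 3)\<^sup>2 * \<tau> ((x 3)\<^sup>2)"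
      using involution_power[OF \<tau>(1) x3n, of 2] by (simp add: d_def power_mult_distrib)
    also have "\<dots> = (of_int \<nu> + x 2) * (of_int \<nu> + of_int b / x 2)"
      unfolding x3(1) using x2n by (simp add: inv subfield_of_int[OF subfield_K] \<tau>2)
    also have "\<dots> = (of_int \<nu>)\<^sup>2 + x 2 * (of_int b / x 2) + of_int \<nu> * w b"
      by (simp add: w_def ring_distribs power2_eq_square)
    also have "\<dots> = of_int (\<nu>\<^sup>2 + b) + of_int \<nu> * w b"
      using x2(1) by simp
    finally have d2: "d\<^sup>2 = of_int (\<nu>\<^sup>2 + b) + of_int \<nu> * w b" .
    have d2_mem: "d\<^sup>2 \<in> K 2"
      unfolding d2 by (intro subfield_closed subfield_K w_mem_K2)
    have "d \<in> K 3"
      using square_descends_to[of 2 d n] u_minus_x_not_square d_mem d2_mem by (auto simp: numeral_3_eq_3)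
    \<comment> \<open>Otherwise \<open>d = c * x 3\<close>, so \<open>\<tau> (x 3) = c\<close> lies
      in \<open>K 2\<close>. As \<open>\<tau>\<close> fixes \<open>W b\<close> and negates
      \<open>x 1\<close>, it maps \<open>K 2\<close> to itself, and \<open>x 3 = \<tau> c\<close>
      would lie there too.\<close>
    have "d \<in> K 2"
    proof (rule ccontr)
      assume "d \<notin> K 2"
      then obtain c where c: "c \<in> K 2" "d = c * x 3"
        using adjoin_sqrt_square[OF subfield_K x3(5,2) _ d2_mem] \<open>d \<in> K 3\<close> x3(4) by metis
      hence \<tau>x3: "\<tau> (x 3) = c" using x3(3) by (simp add: d_def)
      obtain p q where pq: "p \<in> W b" "q \<in> W b" "c = p + q * x 1"
        using adjoin_sqrt_cases[OF subfield_W x1_square_W] c(1) K2_eq by metis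
      have pq': "\<tau> p = p" "\<tau> q = q" "p \<in> K n" "q \<in> K n"
        using pq WF by (auto simp: fixed_field_def)
      have "\<tau> c = p - q * x 1"
        using pq pq' x1n \<tau>(3) by (simp add: inv subfield_mult[OF subfield_K])
      moreover have "p \<in> K 2" "q \<in> K 2" "x 1 \<in> K 2"
        using pq W_subset_K2 x_mem_K'[of 1 2] by auto
      ultimately have "\<tau> c \<in> K 2" using subfield_K[of 2] by (simp add: subfield_closed)
      thus False using \<tau>x3 x3(2) x3n inv(4) by metis
    qed
    hence "d \<in> W b" using FK2 d_fix d_mem by (auto simp: fixed_field_def)
    then obtain e where e: "e \<in> \<rat>" "e\<^sup>2 = (of_int (\<nu>\<^sup>2 + b))\<^sup>2 - (of_int \<nu>)\<^sup>2 * (w b)\<^sup>2"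
      using quadext_norm_square[OF subfield_Rats_CC w_square_Rats w_notin_Rats
          _ d2 Rats_of_int Rats_of_int] unfolding W_def by blast
    \<comment> \<open>The norm of \<open>d\<^sup>2\<close> from \<open>W b\<close> to the rationals
      is identified with \<open>u \<nu> 1 - x0\<close>.\<close>
    have "(\<nu>\<^sup>2 + b)\<^sup>2 - \<nu>\<^sup>2 * (2 * (\<nu> + b)) = \<nu>^4 - 2 * \<nu>^3 + b\<^sup>2"
      by (simp add: algebra_simps power2_eq_square power3_eq_cube power4_eq_xxxx)
    also have "\<dots> = \<nu>^4 - 2 * \<nu>^3 + (\<nu>\<^sup>2 - \<nu> - x0)" using a_square b by simp
    also have "\<dots> = u \<nu> 1 - x0" by (simp add: power2_eq_square power3_eq_cube power4_eq_xxxx algebra_simps)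
    finally have eq: "(\<nu>\<^sup>2 + b)\<^sup>2 - \<nu>\<^sup>2 * (2 * (\<nu> + b)) = u \<nu> 1 - x0" .
    have "e\<^sup>2 = of_int ((\<nu>\<^sup>2 + b)\<^sup>2 - \<nu>\<^sup>2 * (2 * (\<nu> + b)))"
      unfolding e(2) w_square by simp
    hence "e\<^sup>2 = of_int (u \<nu> 1 - x0)" unfolding eq .
    thus False using of_int_square_in_RatsD[OF e(1)] u_not_square[of 1] by blast
  qed
  thus ?thesis using FK2 by (auto simp: fixed_field_def)
qed

end

text \<open>In the exceptional case \<open>x 2 * \<tau> (x 2)\<close> is a square root of
  \<open>a\<^sup>2\<close>; its sign decides between \<open>W a\<close> and
  \<open>W (- a)\<close>.\<close>

lemma index_two_subfield:
  assumes E: "quadext E (K n)"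
  shows "(\<exists>m. n = Suc m \<and> E = K m) \<or> n = 2 \<and> (E = W a \<or> E = W (- a))"
proof -
  obtain \<tau> where \<tau>: "involution_on (K n) \<tau>" "fixed_field (K n) \<tau> = E"
    using quadext_involution[OF E] .
  have ne: "fixed_field (K n) \<tau> \<noteq> K n" using \<tau>(2) quadext_psubset[OF E] by blast
  show ?thesis
  proof (cases rule: involution_cases[OF u_minus_x_not_square \<tau>(1) ne,
        case_names bottom exceptional])
    case (bottom m)
    thus ?thesis using \<tau>(2) by blast
  next
    case (exceptional c)
    have x2n: "x 2 \<in> K n" and x1n: "x 1 \<in> K n" using exceptional x_mem_K' by auto
    have "(\<tau> (x 2))\<^sup>2 = \<tau> (of_int \<nu> + x 1)"
      using involution_power[OF \<tau>(1) x2n, of 2] x2(3) by simp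
    also have "\<dots> = of_int \<nu> - x 1"
      using x1n exceptional by (simp add: involution_add[OF \<tau>(1)] involution_of_int[OF \<tau>(1)]
          subfield_of_int[OF subfield_K])
    finally have "(x 2 * \<tau> (x 2))\<^sup>2 = (of_int a)\<^sup>2"
      using b_square[OF refl] x2(3) by (simp add: power_mult_distrib)
    hence "x 2 * \<tau> (x 2) = of_int a \<or> x 2 * \<tau> (x 2) = of_int (- a)" by (simp add: power2_eq_iff)
    thus ?thesis
      using exceptional_only_K2[of a n \<tau>] exceptional_only_K2[of "- a" n \<tau>] \<tau> exceptional by auto
  qed
qed

text \<open>If they agreed, the field would contain \<open>w a * w (- a) / 2 = x 1\<close>.\<close>

lemma W_neq: "W a \<noteq> W (- a)"
proof
  assume eq: "W a = W (- a)"
  hence "w a \<in> W a" "w (- a) \<in> W a" using adjoin_mem[of "w a" \<rat>] adjoin_mem[of "w (- a)" \<rat>]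
    by (auto simp: W_def)
  hence "w a * w (- a) / 2 \<in> W a" using subfield_W[of a] by (simp add: subfield_closed)
  thus False using w_mult[of a] x1_notin_W[of a] by simp
qed

lemma proper_subfields_square:
  "proper_subfields_of (\<Union>n. K n) = range K \<union> {W (- a), W a}"
proof (intro equalityI subsetI)
  have fin: "F \<in> range K \<union> {W (- a), W a}" if "subfield F CC" "F \<subseteq> K n" for F n
    using that
  proof (induction n)
    case 0
    hence "F = \<rat>" using Rats_subset[of F] K_0 by auto
    thus ?case using Rats_in_range_K by auto
  next
    case (Suc n)
    show ?case
    proof (cases "F = K (Suc n)")
      case False
      then obtain E where E: "F \<subseteq> E" "quadext E (K (Suc n))"
        using qtower_maximal_subfield[OF qtower_K Suc.prems(1)] Suc.prems(2) by blast
      from index_two_subfield[OF E(2)] consider "E = K n" | "E = W a" | "E = W (- a)" by auto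
      thus ?thesis
      proof cases
        case 1
        thus ?thesis using Suc E(1) by auto
      next
        case 2
        have "F = \<rat> \<or> F = W a"
          using quadext_between_cases[OF quadext_W[of a] Suc.prems(1)] E(1) 2
            Rats_subset[OF Suc.prems(1)] by blast
        thus ?thesis using Rats_in_range_K by auto
      next
        case 3
        have "F = \<rat> \<or> F = W (- a)"
          using quadext_between_cases[OF quadext_W[of "- a"] Suc.prems(1)] E(1) 3
            Rats_subset[OF Suc.prems(1)] by auto
        thus ?thesis using Rats_in_range_K by auto
      qed
    qed auto
  qed
  fix F assume "F \<in> proper_subfields_of (\<Union>n. K n)"
  hence F: "subfield F CC" "F \<subset> (\<Union>n. K n)" by (auto simp: proper_subfields_of_def)
  have "\<exists>n. F \<subseteq> K n"
  \<comment> \<open>From level 3 upwards the only index-two subfield is the previous level, hence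
    the bound 2.\<close>
  proof (rule proper_subfield_of_qtower_Union[OF K_mono qtower_K _ F, of 2])
    fix n E assume "2 \<le> n" "quadext E (K (Suc n))"
    thus "E \<subseteq> K n" using index_two_subfield[of E "Suc n"] by auto
  qed
  thus "F \<in> range K \<union> {W (- a), W a}" using fin[OF F(1)] by blast
next
  fix F assume "F \<in> range K \<union> {W (- a), W a}"
  then obtain n where "F \<subseteq> K n" "subfield F CC"
    using subfield_K W_subset_K2[of a] W_subset_K2[of "- a"] subfield_W[of a] subfield_W[of "- a"]
    by auto
  thus "F \<in> proper_subfields_of (\<Union>n. K n)"
    unfolding proper_subfields_of_def using K_psubset_Union[of n] by blast
qed

end

section \<open>The set \<open>\<Omega>\<close>\<close>

lemma xseq_Suc_square: "(xseq \<nu> x0 s (Suc n))\<^sup>2 = of_int \<nu> + xseq \<nu> x0 s n"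
  by simp

lemma sqrt_tower_xseq: "sqrt_tower \<nu> x0 (xseq \<nu> x0 s)"
  by unfold_locales (simp, rule xseq_Suc_square)

lemma tower_K_xseq: "sqrt_tower.K (xseq \<nu> x0 s) = Kn \<nu> x0 s"
  using sqrt_tower.K_def[OF sqrt_tower_xseq] by (auto simp: Kn_def)

lemma proper_sqrt_tower_xseqI:
  assumes "\<And>n. xseq \<nu> x0 s (Suc n) \<notin> Kn \<nu> x0 s n"
  shows "proper_sqrt_tower \<nu> x0 (xseq \<nu> x0 s)"
  using assms by (intro proper_sqrt_tower.intro sqrt_tower_xseq proper_sqrt_tower_axioms.intro)
    (simp add: tower_K_xseq)

lemma subfield_Kn: "subfield (Kn \<nu> x0 s n) CC"
  unfolding Kn_def by (rule subfield_adjoin)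

lemma Kn_mono: "m \<le> n \<Longrightarrow> Kn \<nu> x0 s m \<subseteq> Kn \<nu> x0 s n"
  using sqrt_tower.K_mono[OF sqrt_tower_xseq] by (simp add: tower_K_xseq)

lemma subfield_Kinf: "subfield (Kinf \<nu> x0 s) CC"
  unfolding Kinf_def by (rule subfield_directed_Union[OF Kn_mono subfield_Kn])

section \<open>Growth of \<open>u\<close> and integer squares\<close>

lemma u_ge:
  assumes "\<nu> \<ge> 3"
  shows "u \<nu> n \<ge> \<nu>\<^sup>2 - \<nu>"
proof (induction n)
  case (Suc n)
  have "\<nu>\<^sup>2 \<ge> 3 * \<nu>" using assms by (simp add: power2_eq_square)
  hence "u \<nu> n \<ge> \<nu>" "u \<nu> n \<ge> 2" using Suc assms by linarith+
  moreover have "u \<nu> n * u \<nu> n \<ge> 2 * u \<nu> n" using \<open>u \<nu> n \<ge> 2\<close> by (intro mult_right_mono) auto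
  moreover have "u \<nu> (Suc n) = u \<nu> n * u \<nu> n - \<nu>" by (simp add: power2_eq_square)
  ultimately show ?case using Suc by linarith
qed simp

text \<open>Consecutive squares near \<open>u\<^sub>j\<^sub>-\<^sub>1\<^sup>2\<close> differ by at least \<open>2 u\<^sub>0 - 1 > \<nu>\<^sup>2 \<ge> \<nu> + x\<^sub>0\<close>.\<close>

lemma u_minus_x0_not_square:
  assumes "\<nu> \<ge> 3" "x0 \<ge> 0" "x0 \<le> \<nu>\<^sup>2 - \<nu>" "j \<ge> 1"
  shows "u \<nu> j - x0 \<noteq> (a::int)\<^sup>2"
proof
  assume eq: "u \<nu> j - x0 = a\<^sup>2"
  obtain i where i: "j = Suc i" using assms by (cases j) auto
  define t where "t = u \<nu> i"
  have t: "t \<ge> \<nu>\<^sup>2 - \<nu>" unfolding t_def by (rule u_ge[OF assms(1)])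
  have nu: "\<nu>\<^sup>2 \<ge> 3 * \<nu>" using assms by (simp add: power2_eq_square)
  have e: "t\<^sup>2 - a\<^sup>2 = \<nu> + x0" using eq by (simp add: i t_def)
  hence "a\<^sup>2 < t\<^sup>2" using assms by linarith
  hence "\<bar>a\<bar>\<^sup>2 < t\<^sup>2" by simp
  moreover have "t \<ge> 0" using t nu assms by linarith
  ultimately have "\<bar>a\<bar> < t" by (rule power2_less_imp_less)
  hence "\<bar>a\<bar> \<le> t - 1" by simp
  hence "\<bar>a\<bar>\<^sup>2 \<le> (t - 1)\<^sup>2" by (intro power_mono) auto
  hence "a\<^sup>2 \<le> t\<^sup>2 - 2 * t + 1" by (simp add: power2_eq_square algebra_simps)
  hence "2 * t - 1 \<le> \<nu> + x0" using e by linarith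
  thus False using t nu assms by linarith
qed

lemma int_square_neq_2: "(2::int) \<noteq> a\<^sup>2"
proof
  assume "2 = a\<^sup>2"
  hence "\<bar>a\<bar>\<^sup>2 = 2" by simp
  moreover have "\<bar>a\<bar> \<le> 1 \<or> \<bar>a\<bar> \<ge> 2" by linarith
  ultimately show False using power_mono[of "\<bar>a\<bar>" 1 2] power_mono[of 2 "\<bar>a\<bar>" 2] by auto
qed

lemma u_2 [simp]: "u 2 n = 2"
  by (induction n) auto

section \<open>Embeddings and total reality\<close>

context
  fixes K :: "complex set" and \<sigma>
  assumes K: "subfield K CC" and hom: "\<sigma> \<in> ring_hom (CC\<lparr>carrier := K\<rparr>) CC"
begin

lemma hom_1: "\<sigma> 1 = 1"
  and hom_add: "a \<in> K \<Longrightarrow> b \<in> K \<Longrightarrow> \<sigma> (a + b) = \<sigma> a + \<sigma> b"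
  and hom_mult: "a \<in> K \<Longrightarrow> b \<in> K \<Longrightarrow> \<sigma> (a * b) = \<sigma> a * \<sigma> b"
  using hom unfolding ring_hom_def by auto

lemma hom_uminus: "a \<in> K \<Longrightarrow> \<sigma> (- a) = - \<sigma> a"
  using hom_add[of 0 0] hom_add[of a "- a"] K by (simp add: subfield_closed eq_neg_iff_add_eq_0 add.commute)

lemma hom_inverse: "a \<in> K \<Longrightarrow> a \<noteq> 0 \<Longrightarrow> \<sigma> (inverse a) = inverse (\<sigma> a)"
  using hom_mult[of a "inverse a"] K hom_1 by (simp add: subfield_closed inverse_unique)

lemma subfield_hom_fixed: "subfield {a \<in> K. \<sigma> a = a} CC"
  by (rule subfieldI_CC) (auto simp: hom_1 hom_add hom_mult hom_uminus hom_inverse subfield_closed K)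

lemma subfield_hom_real: "subfield {a \<in> K. \<sigma> a \<in> \<real>} CC"
  by (rule subfieldI_CC) (auto simp: hom_1 hom_add hom_mult hom_uminus hom_inverse subfield_closed K)

end

text \<open>Every embedding maps each generator into the real interval from \<open>- \<nu>\<close>
  to \<open>\<nu>\<^sup>2 - \<nu>\<close>. This interval is preserved: \<open>\<nu> + r\<close> then
  lies between 0 and \<open>\<nu>\<^sup>2\<close>, so its roots are at most
  \<open>\<nu> \<le> \<nu>\<^sup>2 - \<nu>\<close> in absolute value.\<close>

lemma totally_real_Kinf:
  assumes "\<nu> \<ge> 2" "x0 \<ge> 0" "x0 \<le> \<nu>\<^sup>2 - \<nu>"
  shows "totally_real (Kinf \<nu> x0 s)"
  unfolding totally_real_def
proof (intro ballI)
  fix \<sigma> assume \<sigma>: "\<sigma> \<in> ring_hom (CC\<lparr>carrier := Kinf \<nu> x0 s\<rparr>) CC"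
  note K = subfield_Kinf[of \<nu> x0 s]
  have mem: "xseq \<nu> x0 s n \<in> Kinf \<nu> x0 s" for n
    unfolding Kinf_def Kn_def using adjoin_mem by blast
  have int: "\<sigma> (of_int k) = of_int k" for k
    using subfield_of_int[OF subfield_hom_fixed[OF K \<sigma>]] by blast
  have nu: "\<nu>\<^sup>2 \<ge> 2 * \<nu>" using assms by (simp add: power2_eq_square)
  have "\<exists>r. \<sigma> (xseq \<nu> x0 s n) = of_real r \<and> - of_int \<nu> \<le> r \<and> r \<le> of_int (\<nu>\<^sup>2 - \<nu>)" for n
  proof (induction n)
    case 0
    show ?case
      by (rule exI[of _ "of_int x0"]) (use assms int in \<open>auto simp del: of_int_diff\<close>)
  next
    case (Suc n)
    then obtain r where r: "\<sigma> (xseq \<nu> x0 s n) = of_real r" "- of_int \<nu> \<le> r" "r \<le> of_int (\<nu>\<^sup>2 - \<nu>)"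
      by blast
    define y where "y = xseq \<nu> x0 s (Suc n)"
    have "(\<sigma> y)\<^sup>2 = \<sigma> (y\<^sup>2)" using hom_mult[OF K \<sigma>, of y y] mem[of "Suc n"] by (simp add: y_def power2_eq_square)
    also have "y\<^sup>2 = of_int \<nu> + xseq \<nu> x0 s n" unfolding y_def by (rule xseq_Suc_square)
    also have "\<sigma> \<dots> = of_int \<nu> + of_real r"
      using hom_add[OF K \<sigma>, of "of_int \<nu>" "xseq \<nu> x0 s n"] subfield_of_int[OF K] mem int r(1) by simp
    also have "\<dots> = (of_real (sqrt (of_int \<nu> + r)))\<^sup>2"
      using r(2) by (simp flip: of_real_power)
    finally have sq: "\<sigma> y = of_real (sqrt (of_int \<nu> + r)) \<or> \<sigma> y = of_real (- sqrt (of_int \<nu> + r))"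
      by (simp add: power2_eq_iff)
    have "of_int \<nu> + r \<le> (of_int \<nu>)\<^sup>2" using r(3) by simp
    hence "sqrt (of_int \<nu> + r) \<le> of_int \<nu>" using assms by (intro real_le_lsqrt) auto
    moreover have "(of_int \<nu> :: real) \<le> of_int (\<nu>\<^sup>2 - \<nu>)" using nu by (simp only: of_int_le_iff)
    moreover have "sqrt (of_int \<nu> + r) \<ge> 0" using r(2) by simp
    ultimately show ?case
      using sq unfolding y_def by (elim disjE) (rule exI, rule conjI, assumption, linarith)+
  qed
  hence x: "xseq \<nu> x0 s n \<in> {a \<in> Kinf \<nu> x0 s. \<sigma> a \<in> \<real>}" for n
    using mem by (metis (mono_tags, lifting) Reals_of_real mem_Collect_eq)
  have sf: "subfield {a \<in> Kinf \<nu> x0 s. \<sigma> a \<in> \<real>} CC" by (rule subfield_hom_real[OF K \<sigma>])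
  have "Kn \<nu> x0 s n \<subseteq> {a \<in> Kinf \<nu> x0 s. \<sigma> a \<in> \<real>}" for n
    unfolding Kn_def by (rule adjoin_least[OF sf Rats_subset[OF sf]]) (use x in blast)
  thus "\<sigma> ` Kinf \<nu> x0 s \<subseteq> \<real>" unfolding Kinf_def by blast
qed

lemma Omega_bounds:
  assumes "(\<nu>, x0) \<in> Omega"
  shows "\<nu> \<ge> 2" "x0 \<ge> 0" "x0 \<le> \<nu>\<^sup>2 - \<nu>"
proof -
  show nu: "\<nu> \<ge> 2" "x0 \<ge> 0" using assms by (auto simp: Omega_def)
  \<comment> \<open>Negative sign at the first step only: then \<open>x 1\<close> is
    \<open>- sqrt (\<nu> + x0)\<close>, and reality of the next generator forces
    \<open>sqrt (\<nu> + x0) \<le> \<nu>\<close>.\<close>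
  define s where "s n = (n \<noteq> 0)" for n :: nat
  have "totally_real (Kinf \<nu> x0 s)" using assms by (auto simp: Omega_def)
  moreover have "(\<lambda>z. z) \<in> ring_hom (CC\<lparr>carrier := Kinf \<nu> x0 s\<rparr>) CC"
    by (auto simp: ring_hom_def)
  ultimately have "Kinf \<nu> x0 s \<subseteq> \<real>" unfolding totally_real_def by force
  moreover have "xseq \<nu> x0 s 2 \<in> Kinf \<nu> x0 s" unfolding Kinf_def Kn_def using adjoin_mem by blast
  ultimately obtain r where r: "xseq \<nu> x0 s 2 = of_real r" by (auto elim: Reals_cases)
  have "(xseq \<nu> x0 s 2)\<^sup>2 = of_int \<nu> + xseq \<nu> x0 s 1"
    using xseq_Suc_square[of \<nu> x0 s 1] by (simp add: numeral_2_eq_2)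
  also have "xseq \<nu> x0 s 1 = - csqrt (of_real (of_int (\<nu> + x0)))" by (simp add: s_def)
  also have "csqrt (of_real (of_int (\<nu> + x0))) = of_real (sqrt (of_int (\<nu> + x0)))"
    using nu by (simp add: csqrt_of_real_nonneg del: of_int_add)
  finally have "of_real (r\<^sup>2) = (of_real (of_int \<nu> - sqrt (of_int (\<nu> + x0))) :: complex)"
    using r by simp
  hence "r\<^sup>2 = of_int \<nu> - sqrt (of_int (\<nu> + x0))" by (simp only: of_real_eq_iff)
  hence "sqrt (of_int (\<nu> + x0)) \<le> of_int \<nu>" by (metis diff_ge_0_iff_ge zero_le_power2)
  hence "of_int (\<nu> + x0) \<le> (of_int \<nu> :: real)\<^sup>2" by (rule sqrt_le_D)
  hence "of_int (\<nu> + x0) \<le> (of_int (\<nu>\<^sup>2) :: real)" by (simp only: of_int_power)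
  thus "x0 \<le> \<nu>\<^sup>2 - \<nu>" by (simp only: of_int_le_iff)
qed

section \<open>Pairs in \<open>Omega\<close> as towers\<close>

lemma Omega_proper_sqrt_tower:
  assumes "(\<nu>, x0) \<in> Omega"
  shows "proper_sqrt_tower \<nu> x0 (xseq \<nu> x0 s)"
proof (rule proper_sqrt_tower_xseqI)
  fix n
  have "has_degree (Kn \<nu> x0 s (Suc n)) (Kn \<nu> x0 s n) 2" using assms by (auto simp: Omega_def)
  hence "Kn \<nu> x0 s n \<subset> Kn \<nu> x0 s (Suc n)"
    using quadext_psubset[OF has_degree_quadext] subfield_Kn by blast
  moreover have "Kn \<nu> x0 s (Suc n) \<subseteq> Kn \<nu> x0 s n" if "xseq \<nu> x0 s (Suc n) \<in> Kn \<nu> x0 s n"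
    using sqrt_tower.K_least[OF sqrt_tower_xseq subfield_Kn] that by (simp only: tower_K_xseq)
  ultimately show "xseq \<nu> x0 s (Suc n) \<notin> Kn \<nu> x0 s n" by blast
qed

lemma OmegaI:
  assumes "\<nu> \<ge> 2" "x0 \<ge> 0" "x0 \<le> \<nu>\<^sup>2 - \<nu>" "\<And>s. proper_sqrt_tower \<nu> x0 (xseq \<nu> x0 s)"
  shows "(\<nu>, x0) \<in> Omega"
proof -
  have "has_degree (Kn \<nu> x0 s (Suc n)) (Kn \<nu> x0 s n) 2" for s n
    using quadext_has_degree[OF proper_sqrt_tower.quadext_K[OF assms(4)[of s]], of n]
    by (simp only: tower_K_xseq)
  thus ?thesis using assms totally_real_Kinf by (auto simp: Omega_def)
qed

text \<open>The second hypothesis excludes \<open>x0 = 1\<close> and \<open>x0 = 2\<close> for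
  \<open>\<nu> = 2\<close>, where \<open>u 2 j - x0\<close> is 1 or 0, a square for all
  \<open>j\<close>.\<close>

lemma Omega_rigid_sqrt_tower:
  assumes "(\<nu>, x0) \<in> Omega" "\<nu> \<ge> 3 \<or> x0 = 0"
  shows "rigid_sqrt_tower \<nu> x0 (xseq \<nu> x0 s)"
proof (intro rigid_sqrt_tower.intro Omega_proper_sqrt_tower assms rigid_sqrt_tower_axioms.intro)
  fix j :: nat and a :: int assume "j \<ge> 1"
  show "u \<nu> j - x0 \<noteq> a\<^sup>2"
  proof (cases "\<nu> \<ge> 3")
    case True
    thus ?thesis using u_minus_x0_not_square[OF _ Omega_bounds(2,3)[OF assms(1)] \<open>j \<ge> 1\<close>] by blast
  next
    case False
    hence "\<nu> = 2" "x0 = 0" using Omega_bounds[OF assms(1)] assms(2) by auto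
    thus ?thesis using int_square_neq_2 by simp
  qed
qed

lemma proper_subfields_Omega_nonsquare:
  assumes "(\<nu>, x0) \<in> Omega" "\<nexists>a::int. u \<nu> 0 - x0 = a\<^sup>2"
  shows "proper_subfields_of (Kinf \<nu> x0 s) = range (Kn \<nu> x0 s)"
proof -
  \<comment> \<open>For \<open>\<nu> = 2\<close> the bounds leave \<open>x0\<close> in {0, 1, 2},
    and the last two give the squares 1 and 0.\<close>
  have "\<nu> \<ge> 3 \<or> x0 = 0"
  proof (rule ccontr)
    assume "\<not> (\<nu> \<ge> 3 \<or> x0 = 0)"
    moreover from this have "\<nu> = 2" using Omega_bounds(1)[OF assms(1)] by simp
    ultimately have "\<nu> = 2" "x0 = 1 \<or> x0 = 2" using Omega_bounds(2,3)[OF assms(1)] by auto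
    thus False using assms(2) spec[of "\<lambda>a::int. \<not> u \<nu> 0 - x0 = a\<^sup>2" 1] spec[of "\<lambda>a::int. \<not> u \<nu> 0 - x0 = a\<^sup>2" 0]
      by auto
  qed
  from rigid_sqrt_tower.proper_subfields_nonsquare[OF Omega_rigid_sqrt_tower[OF assms(1) this] assms(2)]
  show ?thesis by (simp only: tower_K_xseq Kinf_def)
qed

lemma Omega_square_sqrt_tower:
  assumes "(\<nu>, x0) \<in> Omega" "\<nu> \<ge> 3" "u \<nu> 0 - x0 = a\<^sup>2"
  shows "square_sqrt_tower \<nu> x0 (xseq \<nu> x0 s) a"
  using assms Omega_bounds[OF assms(1)]
  by (intro square_sqrt_tower.intro Omega_rigid_sqrt_tower square_sqrt_tower_axioms.intro) auto

text \<open>A square root of \<open>\<nu> + x\<^sub>1\<close> in \<open>K\<^sub>1\<close> would have rational trace, and the square of the trace would be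
  \<open>2 (\<nu> \<plusminus> 1)\<close>, which is \<open>2\<close> modulo \<open>4\<close>.\<close>

lemma (in sqrt_tower) family_step:
  assumes k: "\<nu> = 4 * k" and nu: "\<nu> \<ge> 4" and x0: "x0 = \<nu>\<^sup>2 - \<nu> - 1"
    and bounds: "x0 \<ge> 0" "x0 \<le> \<nu>\<^sup>2 - \<nu>"
  shows "x (Suc n) \<notin> K n"
proof (induction n rule: less_induct)
  case (less n)
  consider "n = 0" | "n = 1" | m where "n = Suc m" "m \<ge> 1"
    by (cases n; cases "n - 1") auto
  thus ?case
  proof cases
    case 1
    show ?thesis
    proof
      assume "x (Suc n) \<in> K n"
      then obtain a :: int where a: "\<nu> + x0 = a\<^sup>2"
        using of_int_square_in_RatsD[of "x 1" "\<nu> + x0"] x_Suc[of 0] 1 K_0 x_0 by auto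
      \<comment> \<open>This number lies strictly between the squares of \<open>\<nu> - 1\<close>
        and \<open>\<nu>\<close>.\<close>
      hence e: "\<nu>\<^sup>2 - 1 = \<bar>a\<bar>\<^sup>2" by (simp add: x0)
      hence "\<bar>a\<bar>\<^sup>2 < \<nu>\<^sup>2" by simp
      hence "\<bar>a\<bar> < \<nu>" by (rule power2_less_imp_less) (use nu in simp)
      hence "\<bar>a\<bar>\<^sup>2 \<le> (\<nu> - 1)\<^sup>2" by (intro power_mono) auto
      moreover have "(\<nu> - 1)\<^sup>2 = \<nu>\<^sup>2 - 2 * \<nu> + 1" by (simp add: power2_eq_square algebra_simps)
      ultimately show False using e nu by linarith
    qed
  next
    case 2
    show ?thesis
    proof
      assume "x (Suc n) \<in> K n"
      hence y: "x 2 \<in> adjoin \<rat> {x 1}" using 2 K_Suc[of 0] K_0 by (simp add: numeral_2_eq_2)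
      have x1: "x 1 \<notin> \<rat>" "(x 1)\<^sup>2 = of_int (\<nu> + x0)" using less[of 0] 2 K_0 x_Suc[of 0] x_0 by auto
      have x2: "(x 2)\<^sup>2 = of_int \<nu> + x 1" using x_Suc[of 1] by (simp add: numeral_2_eq_2)
      obtain \<tau> where \<tau>: "involution_on (adjoin \<rat> {x 1}) \<tau>"
        "fixed_field (adjoin \<rat> {x 1}) \<tau> = \<rat>" "\<tau> (x 1) = - x 1"
        using quadext_conj[OF subfield_Rats_CC _ x1(1)] x1(2) by auto
      note inv = involution_add[OF \<tau>(1)] involution_mult[OF \<tau>(1)] involution_mem[OF \<tau>(1)]
        involution_invol[OF \<tau>(1)] involution_of_int[OF \<tau>(1)]
      define b where "b = x 2 * \<tau> (x 2)"
      define w where "w = x 2 + \<tau> (x 2)"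
      have "b \<in> fixed_field (adjoin \<rat> {x 1}) \<tau>" "w \<in> fixed_field (adjoin \<rat> {x 1}) \<tau>"
        using y by (auto simp: fixed_field_def b_def w_def inv subfield_add subfield_mult
            subfield_adjoin mult.commute simp del: One_nat_def)
      hence rat: "b \<in> \<rat>" "w \<in> \<rat>" using \<tau>(2) by auto
      have "(\<tau> (x 2))\<^sup>2 = \<tau> ((x 2)\<^sup>2)" using involution_power[OF \<tau>(1) y, of 2] by simp
      also have "\<dots> = of_int \<nu> - x 1"
        unfolding x2 using adjoin_mem[of "x 1" \<rat>] \<tau>(3)
        by (simp add: inv subfield_of_int[OF subfield_adjoin] del: One_nat_def)
      finally have t2: "(\<tau> (x 2))\<^sup>2 = of_int \<nu> - x 1" .
      have "b\<^sup>2 = (of_int \<nu> + x 1) * (of_int \<nu> - x 1)"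
        by (simp only: b_def power_mult_distrib x2 t2)
      also have "\<dots> = (of_int \<nu>)\<^sup>2 - (x 1)\<^sup>2" by (simp add: algebra_simps power2_eq_square)
      also have "\<dots> = of_int 1" unfolding x1(2) by (simp add: x0)
      finally obtain c where c: "1 = c\<^sup>2" "b = of_int c"
        using of_int_square_in_RatsD[OF rat(1)] by blast
      have "w\<^sup>2 = (x 2)\<^sup>2 + (\<tau> (x 2))\<^sup>2 + 2 * b" by (simp add: w_def b_def power2_sum)
      also have "\<dots> = of_int (2 * \<nu> + 2 * c)" by (simp only: x2 t2 c(2)) simp
      finally obtain d where d: "2 * \<nu> + 2 * c = d\<^sup>2"
        using of_int_square_in_RatsD[OF rat(2)] by blast
      have "c = 1 \<or> c = - 1" using c(1)[symmetric] by (simp only: power2_eq_1_iff)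
      hence "d\<^sup>2 mod 4 = 2" unfolding d[symmetric] k by presburger
      moreover have "d mod 4 = 0 \<or> d mod 4 = 1 \<or> d mod 4 = 2 \<or> d mod 4 = 3" by presburger
      hence "d\<^sup>2 mod 4 = 0 \<or> d\<^sup>2 mod 4 = 1"
        by (elim disjE) (simp_all add: power2_eq_square mod_mult_eq[of d 4 d, symmetric])
      ultimately show False by simp
    qed
  next
    case (3 m)
    show ?thesis unfolding 3(1)
      by (rule step_SucI) (use less 3 u_minus_x0_not_square[OF _ bounds 3(2)] nu in auto)
  qed
qed

text \<open>This \<open>x0\<close> makes \<open>u \<nu> 0 - x0 = 1\<close>, so each member falls
  under the square case with \<open>a = 1\<close>.\<close>

lemma Omega_family:
  assumes "k \<ge> 1"
  shows "(4 * k, (4 * k)\<^sup>2 - 4 * k - 1) \<in> Omega"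
proof -
  define \<nu> where "\<nu> = 4 * k"
  define x0 where "x0 = \<nu>\<^sup>2 - \<nu> - 1"
  have nu: "\<nu> \<ge> 4" using assms by (simp add: \<nu>_def)
  hence "\<nu>\<^sup>2 \<ge> 4 * \<nu>" by (simp add: power2_eq_square)
  hence bounds: "x0 \<ge> 0" "x0 \<le> \<nu>\<^sup>2 - \<nu>" using nu by (auto simp: x0_def)
  have "(\<nu>, x0) \<in> Omega"
  proof (rule OmegaI)
    fix s
    have "xseq \<nu> x0 s (Suc n) \<notin> Kn \<nu> x0 s n" for n
      using sqrt_tower.family_step[OF sqrt_tower_xseq \<nu>_def nu x0_def bounds] by (simp only: tower_K_xseq) simp
    thus "proper_sqrt_tower \<nu> x0 (xseq \<nu> x0 s)" by (rule proper_sqrt_tower_xseqI)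
  qed (use nu bounds in auto)
  thus ?thesis by (simp add: \<nu>_def x0_def)
qed

lemma infinite_Omega_square:
  "infinite {(\<nu>, x0). (\<nu>, x0) \<in> Omega \<and> \<nu> \<ge> 3 \<and> (\<exists>a::int. u \<nu> 0 - x0 = a\<^sup>2)}" (is "infinite ?S")
proof -
  define f :: "nat \<Rightarrow> int \<times> int" where
    "f m = (4 * (int m + 1), (4 * (int m + 1))\<^sup>2 - 4 * (int m + 1) - 1)" for m
  have "inj f" by (rule injI) (simp add: f_def)
  moreover have "range f \<subseteq> ?S"
  proof
    fix p assume "p \<in> range f"
    then obtain m where "p = f m" by blast
    moreover have "f m \<in> Omega" unfolding f_def by (rule Omega_family) simp
    moreover have "\<exists>a::int. u (fst (f m)) 0 - snd (f m) = a\<^sup>2" by (rule exI[of _ 1]) (simp add: f_def)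
    moreover have "fst (f m) \<ge> 3" by (simp add: f_def)
    ultimately show "p \<in> ?S" by (simp add: case_prod_beta)
  qed
  ultimately show ?thesis using range_inj_infinite infinite_super by blast
qed

section \<open>The towers \<open>(2, 0)\<close> and \<open>(2, 1)\<close>\<close>

lemma two_cos_nat_mult_mem:
  assumes F: "subfield F CC" and \<theta>: "of_real (2 * cos \<theta>) \<in> F"
  shows "of_real (2 * cos (real n * \<theta>)) \<in> F"
proof (induction n rule: less_induct)
  case (less n)
  consider "n = 0" | "n = 1" | m where "n = Suc (Suc m)"
    by (cases n; cases "n - 1") auto
  thus ?case
  proof cases
    case 1
    thus ?thesis using subfield_numeral[OF F] by simp
  next
    case 2
    thus ?thesis using \<theta> by simp
  next
    case (3 m)
    \<comment> \<open>The Chebyshev recursion for \<open>2 * cos (n * \<theta>)\<close>.\<close>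
    have "cos (real n * \<theta>) + cos (real m * \<theta>) = 2 * cos (real (Suc m) * \<theta>) * cos \<theta>"
      using cos_add[of "real (Suc m) * \<theta>" \<theta>] cos_diff[of "real (Suc m) * \<theta>" \<theta>]
      by (simp add: 3 algebra_simps)
    hence "2 * cos (real n * \<theta>) = (2 * cos (real (Suc m) * \<theta>)) * (2 * cos \<theta>) - 2 * cos (real m * \<theta>)"
      by (simp add: algebra_simps)
    moreover have "of_real ((2 * cos (real (Suc m) * \<theta>)) * (2 * cos \<theta>) - 2 * cos (real m * \<theta>)) \<in> F"
      unfolding of_real_diff[where 'a = complex] of_real_mult[of "2 * cos (real (Suc m) * \<theta>)", where 'a = complex]
      using less[of "Suc m"] less[of m] 3 \<theta> by (intro subfield_diff subfield_mult F) auto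
    ultimately show ?thesis by simp
  qed
qed

lemma two_cos_int_mult_mem:
  assumes "subfield F CC" "of_real (2 * cos \<theta>) \<in> F"
  shows "of_real (2 * cos (of_int k * \<theta>)) \<in> F"
proof (cases k)
  case (nonneg n)
  thus ?thesis using two_cos_nat_mult_mem[OF assms, of n] by simp
next
  case (neg n)
  thus ?thesis using two_cos_nat_mult_mem[OF assms, of "Suc n"]
    by (metis cos_minus mult_minus_left of_int_minus of_int_of_nat_eq)
qed

text \<open>By the half-angle formula a root of \<open>2 + 2 * cos (2 * \<phi>)\<close> is
  \<open>2 * cos \<phi>\<close> up to sign, and the sign is absorbed into \<open>j\<close>.\<close>

lemma sqrt_tower_2_0_cos:
  assumes "sqrt_tower 2 0 y"
  shows "\<exists>j. odd j \<and> y n = of_real (2 * cos (of_int j * (pi / 2 ^ Suc n)))"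
proof (induction n)
  case 0
  show ?case using sqrt_tower.x_0[OF assms] by (intro exI[of _ 1]) simp
next
  case (Suc n)
  then obtain j where j: "odd j" "y n = of_real (2 * cos (of_int j * (pi / 2 ^ Suc n)))" by blast
  define \<phi> where "\<phi> = of_int j * (pi / 2 ^ Suc (Suc n))"
  have "of_int j * (pi / 2 ^ Suc n) = 2 * \<phi>" by (simp add: \<phi>_def)
  hence "y n = of_real (2 * cos (2 * \<phi>))" using j(2) by simp
  hence "(y (Suc n))\<^sup>2 = of_real (2 + 2 * cos (2 * \<phi>))" using sqrt_tower.x_Suc[OF assms, of n] by simp
  also have "2 + 2 * cos (2 * \<phi>) = (2 * cos \<phi>)\<^sup>2"
    by (simp add: cos_double_cos power_mult_distrib)
  finally have "(y (Suc n))\<^sup>2 = (of_real (2 * cos \<phi>))\<^sup>2" by simp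
  hence "y (Suc n) = of_real (2 * cos \<phi>) \<or> y (Suc n) = - of_real (2 * cos \<phi>)"
    by (simp only: power2_eq_iff)
  thus ?case
  proof
    assume "y (Suc n) = of_real (2 * cos \<phi>)"
    thus ?thesis using j(1) unfolding \<phi>_def by blast
  next
    assume *: "y (Suc n) = - of_real (2 * cos \<phi>)"
    \<comment> \<open>The shift of \<open>j\<close> adds \<open>pi\<close> to the angle, which flips
      the cosine, and keeps \<open>j\<close> odd.\<close>
    have "of_int (j + 2 ^ Suc (Suc n)) * (pi / 2 ^ Suc (Suc n)) = \<phi> + pi"
      by (simp add: \<phi>_def distrib_right)
    hence "y (Suc n) = of_real (2 * cos (of_int (j + 2 ^ Suc (Suc n)) * (pi / 2 ^ Suc (Suc n))))"
      using * by (simp only: cos_periodic_pi) simp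
    moreover have "odd (j + 2 ^ Suc (Suc n))" using j(1) by simp
    ultimately show ?thesis by blast
  qed
qed

text \<open>An odd \<open>j\<close> is invertible modulo \<open>2 ^ Suc (Suc n)\<close>, so modulo
  \<open>2 * pi\<close> the angle of \<open>y' n\<close> is an integer multiple of that of
  \<open>y n\<close>.\<close>

lemma sqrt_tower_2_0_mem:
  assumes "sqrt_tower 2 0 y" "sqrt_tower 2 0 y'"
  shows "y' n \<in> adjoin \<rat> {y n}"
proof -
  define \<alpha> where "\<alpha> = pi / 2 ^ Suc n"
  obtain j where j: "odd j" "y n = of_real (2 * cos (of_int j * \<alpha>))"
    using sqrt_tower_2_0_cos[OF assms(1)] \<alpha>_def by blast
  obtain j' where j': "odd j'" "y' n = of_real (2 * cos (of_int j' * \<alpha>))"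
    using sqrt_tower_2_0_cos[OF assms(2)] \<alpha>_def by blast
  have "coprime j (2 ^ Suc (Suc n))"
    using j(1) by (simp only: coprime_power_right_iff coprime_right_2_iff_odd) simp
  then obtain a b where ab: "a * j + b * 2 ^ Suc (Suc n) = 1"
    using bezout_int[of j "2 ^ Suc (Suc n)"] by auto
  have "j' = (a * j') * j + (b * j') * 2 ^ Suc (Suc n)"
    using arg_cong[OF ab, of "\<lambda>t. j' * t"] by (simp add: algebra_simps)
  hence "of_int j' * \<alpha> = of_int ((a * j') * j + (b * j') * 2 ^ Suc (Suc n)) * \<alpha>" by simp
  also have "\<dots> = of_int (a * j') * (of_int j * \<alpha>) + of_int (b * j') * (2 ^ Suc (Suc n) * \<alpha>)"
    by (simp add: algebra_simps)
  also have "2 ^ Suc (Suc n) * \<alpha> = 2 * pi" by (simp add: \<alpha>_def)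
  finally have "of_int j' * \<alpha> = of_int (a * j') * (of_int j * \<alpha>) + of_int (b * j') * (2 * pi)" .
  moreover have "cos (\<beta> + of_int (b * j') * (2 * pi)) = cos \<beta>" for \<beta>
    using cos_int_2pin[of "b * j'"] sin_int_2pin[of "b * j'"]
    by (simp add: cos_add mult.commute[of _ "2 * pi"] del: of_int_mult)
  ultimately have "y' n = of_real (2 * cos (of_int (a * j') * (of_int j * \<alpha>)))"
    using j'(2) by (simp only:)
  moreover have "of_real (2 * cos (of_int j * \<alpha>)) \<in> adjoin \<rat> {y n}"
    using adjoin_mem[of "y n" \<rat>] j(2) by (simp only:)
  ultimately show ?thesis
    using two_cos_int_mult_mem[OF subfield_adjoin[of \<rat> "{y n}"]] by (simp only:)
qed

lemma sqrt_tower_2_0_unique: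
  assumes "sqrt_tower 2 0 y" "sqrt_tower 2 0 y'"
  shows "sqrt_tower.K y' = sqrt_tower.K y"
  unfolding sqrt_tower.K_def[OF assms(1), abs_def] sqrt_tower.K_def[OF assms(2), abs_def]
  by (intro ext adjoin_Rats_eqI sqrt_tower_2_0_mem assms)

text \<open>Here \<open>u 2 j = 2\<close> for all \<open>j\<close>, which is not a square, so
  \<open>step_SucI\<close> applies throughout.\<close>

lemma sqrt_tower_2_0_rigid:
  assumes "sqrt_tower 2 0 y"
  shows "rigid_sqrt_tower 2 0 y"
proof -
  interpret sqrt_tower 2 0 y by fact
  have "y (Suc n) \<notin> K n" for n
  proof (induction n rule: less_induct)
    case (less n)
    show ?case
    proof (cases n)
      case 0
      thus ?thesis using of_int_square_in_RatsD[of "y 1" 2] x_Suc[of 0] x_0 K_0 int_square_neq_2 by auto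
    next
      case (Suc m)
      show ?thesis unfolding Suc by (rule step_SucI) (use less Suc int_square_neq_2 in auto)
    qed
  qed
  thus ?thesis using int_square_neq_2 by unfold_locales auto
qed

section \<open>Comparison of the towers over 0 and 1\<close>

lemma int_square_neq_3_6: "(3::int) \<noteq> a\<^sup>2" "(6::int) \<noteq> a\<^sup>2"
proof -
  have "\<bar>a\<bar>\<^sup>2 = a\<^sup>2" by simp
  moreover consider "\<bar>a\<bar> \<le> 1" | "\<bar>a\<bar> = 2" | "\<bar>a\<bar> \<ge> 3" by linarith
  hence "\<bar>a\<bar>\<^sup>2 \<le> 1 \<or> \<bar>a\<bar>\<^sup>2 = 4 \<or> \<bar>a\<bar>\<^sup>2 \<ge> 9"
    using power_mono[of "\<bar>a\<bar>" 1 2] power_mono[of 3 "\<bar>a\<bar>" 2] by cases auto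
  ultimately show "3 \<noteq> a\<^sup>2" "6 \<noteq> a\<^sup>2" by auto
qed

text \<open>The tower over 1 is not rigid, since \<open>u 2 j - 1 = 1\<close> is a square; its
  fields are described through the rigid tower over 0. The signs in the two towers are
  independent.\<close>

locale double_tower = L: rigid_sqrt_tower 2 0 y + X: sqrt_tower 2 1 x for y x
begin

abbreviation L :: "nat \<Rightarrow> complex set" where "L \<equiv> L.K"

abbreviation r :: complex where "r \<equiv> sqrtC 3"

text \<open>This turns out to be level \<open>Suc n\<close> of the tower over 1
  (\<open>XK_Suc_eq_R\<close>).\<close>

definition R :: "nat \<Rightarrow> complex set" where "R n = adjoin (L n) {r}"

definition M :: "nat \<Rightarrow> complex set" where "M n = adjoin \<rat> {r * y n}"

lemma r_square: "r\<^sup>2 = 3"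
  unfolding sqrtC_def power2_csqrt by simp

lemma r_nonzero: "r \<noteq> 0"
  using r_square by auto

lemma y_Suc: "(y (Suc n))\<^sup>2 = 2 + y n" and y_0: "y 0 = 0"
  using L.x_Suc[of n] L.x_0 by auto

lemma x_Suc: "(x (Suc n))\<^sup>2 = 2 + x n" and x_0: "x 0 = 1"
  using X.x_Suc[of n] X.x_0 by auto

lemma L_psubset: "L n \<subset> L (Suc n)"
  by (rule L.K_strict_mono) simp

text \<open>As \<open>r\<^sup>2\<close> is rational, \<open>r\<close> would descend to level 1,
  which is generated by a root of 2. Then \<open>r = c * y 1\<close> with \<open>c\<close> rational,
  and 6 would be a square.\<close>

lemma r_notin_L: "r \<notin> L n"
proof
  assume "r \<in> L n"
  moreover have "r\<^sup>2 \<in> L 0" using subfield_numeral[OF L.subfield_K] by (simp add: r_square)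
  moreover have "c\<^sup>2 \<noteq> of_int (u 2 0) - y k" if "c \<in> L k" for c k
    using L.u_minus_x_square_imp[OF L.step that, of 0] int_square_neq_2 by auto
  ultimately have "r \<in> L (Suc 0)" using L.square_descends_to[of 0 r n] by blast
  moreover have r_Rats: "r \<notin> \<rat>"
    using of_int_square_in_RatsD[of r 3] r_square int_square_neq_3_6 by auto
  ultimately obtain c where c: "c \<in> \<rat>" "r = c * y 1"
    using adjoin_sqrt_square[OF L.subfield_K[of 0] L.x_Suc_square_mem L.step, of r]
      \<open>r\<^sup>2 \<in> L 0\<close> L.K_Suc[of 0] L.K_0 by auto
  have "(2 * c)\<^sup>2 = of_int 6"
    using r_square c(2) y_Suc[of 0] y_0 by (simp add: power_mult_distrib mult.commute)
  thus False using of_int_square_in_RatsD[of "2 * c" 6] c(1) int_square_neq_3_6 by auto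
qed

lemma subfield_R: "subfield (R n) CC" and subfield_M: "subfield (M n) CC"
  unfolding R_def M_def by (rule subfield_adjoin)+

lemma r_mem_R: "r \<in> R n" and L_subset_R: "L n \<subseteq> R n"
  unfolding R_def using adjoin_mem adjoin_incl(1) by blast+

lemma R_mono: "m \<le> n \<Longrightarrow> R m \<subseteq> R n"
  using L.K_mono[of m n] L_subset_R[of n] r_mem_R[of n]
  unfolding R_def[of m] by (intro adjoin_least subfield_R) auto

lemma r_square_mem: "subfield F CC \<Longrightarrow> r\<^sup>2 \<in> F"
  by (simp add: r_square subfield_numeral)

lemma quadext_L_R: "quadext (L n) (R n)"
  unfolding R_def by (rule quadextI[OF L.subfield_K r_square_mem[OF L.subfield_K] r_notin_L])

text \<open>The triple-angle map \<open>2 cos \<theta> \<mapsto> 2 cos 3\<theta>\<close> takes the tower over \<open>1\<close> to a tower over \<open>0\<close>.\<close>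

definition z :: "nat \<Rightarrow> complex" where "z n = x (Suc n) * ((x (Suc n))\<^sup>2 - 3)"

lemma sqrt_tower_z: "sqrt_tower 2 0 z"
proof
  show "z 0 = of_int 0" using x_Suc[of 0] x_0 by (simp add: z_def)
  fix n
  have "(z (Suc n))\<^sup>2 = (x (Suc (Suc n)))\<^sup>2 * ((x (Suc (Suc n)))\<^sup>2 - 3)\<^sup>2"
    by (simp add: z_def power_mult_distrib)
  \<comment> \<open>With \<open>t = x (Suc n)\<close> this is the identity (t + 2)(t - 1)^2 = 2 +
    t^3 - 3 t.\<close>
  also have "\<dots> = 2 + x (Suc n) * ((x (Suc n))\<^sup>2 - 3)"
    unfolding x_Suc[of "Suc n"] by (simp add: power2_eq_square algebra_simps)
  finally show "(z (Suc n))\<^sup>2 = of_int 2 + z n" by (simp add: z_def)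
qed

lemma adjoin_z: "adjoin \<rat> {z n} = L n"
  using fun_cong[OF sqrt_tower_2_0_unique[OF L.sqrt_tower_axioms sqrt_tower_z], of n]
  unfolding sqrt_tower.K_def[OF sqrt_tower_z] .

text \<open>Makes the division by \<open>x (Suc n) - 1\<close> in \<open>x_mem_R\<close>
  legitimate.\<close>

lemma x_square_neq_1: "(x (Suc n))\<^sup>2 \<noteq> 1"
proof (induction n)
  case 0
  show ?case using x_Suc[of 0] x_0 by simp
next
  case (Suc n)
  show ?case
  proof
    assume "(x (Suc (Suc n)))\<^sup>2 = 1"
    hence "x (Suc n) = 1 - 2" using x_Suc[of "Suc n"] by (metis add_diff_cancel_left')
    thus False using Suc by simp
  qed
qed

lemma x_1: "x (Suc 0) = r \<or> x (Suc 0) = - r"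
  using x_Suc[of 0] x_0 r_square by (simp add: power2_eq_iff[symmetric])

text \<open>Since \<open>(x (Suc (Suc n)))\<^sup>2 - 3 = x (Suc n) - 1\<close>, the next generator
  is the quotient of \<open>z (Suc n)\<close>, an element of \<open>L (Suc n)\<close>, by
  \<open>x (Suc n) - 1\<close>. The start is a square root of 3.\<close>

lemma x_mem_R: "x (Suc n) \<in> R n"
proof (induction n)
  case 0
  show ?case using x_1 r_mem_R[of 0] subfield_uminus[OF subfield_R] by auto
next
  case (Suc n)
  have "x (Suc n) \<noteq> 1" using x_square_neq_1[of n] by auto
  hence "x (Suc (Suc n)) = z (Suc n) / (x (Suc n) - 1)" by (simp add: z_def x_Suc[of "Suc n"])
  moreover have "z (Suc n) \<in> R (Suc n)" using adjoin_z adjoin_mem[of "z (Suc n)" \<rat>] L_subset_R by blast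
  moreover have "x (Suc n) \<in> R (Suc n)" using Suc R_mono[of n "Suc n"] by auto
  ultimately show ?case using subfield_R[of "Suc n"] by (simp add: subfield_closed)
qed

lemma XK_Suc_eq_R: "X.K (Suc n) = R n"
proof (rule equalityI)
  show "X.K (Suc n) \<subseteq> R n" by (rule X.K_least[OF subfield_R x_mem_R])
  have "z n \<in> X.K (Suc n)"
    unfolding z_def using X.x_mem_K[of "Suc n"] by (intro subfield_closed X.subfield_K)
  hence "L n \<subseteq> X.K (Suc n)"
    unfolding adjoin_z[symmetric] by (intro adjoin_least X.subfield_K Rats_subset) auto
  moreover have "x (Suc 0) \<in> X.K (Suc n)" by (rule X.x_mem_K') simp
  hence "r \<in> X.K (Suc n)" using x_1 subfield_uminus[OF X.subfield_K, of "x (Suc 0)" "Suc n"] by auto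
  ultimately show "R n \<subseteq> X.K (Suc n)" unfolding R_def by (intro adjoin_least X.subfield_K) auto
qed

text \<open>Otherwise \<open>L (Suc n)\<close> would equal the quadratic extension
  \<open>R n\<close> of \<open>L n\<close> and contain \<open>r\<close>.\<close>

lemma y_notin_R: "y (Suc n) \<notin> R n"
proof
  assume "y (Suc n) \<in> R n"
  hence "L (Suc n) \<subseteq> R n" by (rule L.K_least[OF subfield_R])
  hence "L (Suc n) = L n \<or> L (Suc n) = R n"
    using quadext_between_cases[OF quadext_L_R L.subfield_K L.K_Suc_mono] by blast
  thus False using L_psubset[of n] r_notin_L[of "Suc n"] r_mem_R[of n] by auto
qed

lemma y_square_mem_R: "(y (Suc n))\<^sup>2 \<in> R n"
  using L.x_Suc_square_mem L_subset_R by blast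

lemma R_Suc: "R (Suc n) = adjoin (R n) {y (Suc n)}"
proof (rule equalityI)
  have *: "R n \<subseteq> adjoin (R n) {y (Suc n)}" by (rule adjoin_incl)
  have "L (Suc n) \<subseteq> adjoin (R n) {y (Suc n)}"
    by (rule L.K_least[OF subfield_adjoin adjoin_mem])
  moreover have "r \<in> adjoin (R n) {y (Suc n)}" using * r_mem_R by blast
  ultimately show "R (Suc n) \<subseteq> adjoin (R n) {y (Suc n)}"
    unfolding R_def[of "Suc n"] by (intro adjoin_least subfield_adjoin) auto
  show "adjoin (R n) {y (Suc n)} \<subseteq> R (Suc n)"
    using R_mono[of n "Suc n"] L_subset_R[of "Suc n"] L.x_mem_K[of "Suc n"]
    by (intro adjoin_least subfield_R) auto
qed

lemma quadext_R: "quadext (R n) (R (Suc n))"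
  unfolding R_Suc by (rule quadextI[OF subfield_R y_square_mem_R y_notin_R])

lemma ry_square: "(r * y (Suc n))\<^sup>2 = 3 * (2 + y n)"
  by (simp add: power_mult_distrib r_square y_Suc)

lemma ry_square_mem: "(r * y (Suc n))\<^sup>2 \<in> L n"
  unfolding ry_square using L.x_mem_K by (intro subfield_closed L.subfield_K)

lemma L_subset_M: "L n \<subseteq> M (Suc n)"
proof (rule L.K_least[OF subfield_M])
  have "y n = (r * y (Suc n))\<^sup>2 / 3 - 2" by (simp add: ry_square)
  moreover have "r * y (Suc n) \<in> M (Suc n)" unfolding M_def by (rule adjoin_mem)
  ultimately show "y n \<in> M (Suc n)" using subfield_M[of "Suc n"] by (simp add: subfield_closed)
qed

lemma M_Suc: "M (Suc n) = adjoin (L n) {r * y (Suc n)}"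
proof (rule equalityI)
  show "M (Suc n) \<subseteq> adjoin (L n) {r * y (Suc n)}"
    unfolding M_def using adjoin_mem by (intro adjoin_least subfield_adjoin Rats_subset) auto
  show "adjoin (L n) {r * y (Suc n)} \<subseteq> M (Suc n)"
    using L_subset_M by (intro adjoin_least subfield_M) (auto simp: M_def adjoin_mem)
qed

lemma ry_notin_L: "r * y (Suc n) \<notin> L m"
proof
  assume "r * y (Suc n) \<in> L m"
  hence "r * y (Suc n) \<in> L (max m (Suc n))" using L.K_mono[of m "max m (Suc n)"] by auto
  moreover have "y (Suc n) \<in> L (max m (Suc n))" by (rule L.x_mem_K') simp
  ultimately have "r * y (Suc n) / y (Suc n) \<in> L (max m (Suc n))" by (intro subfield_divide L.subfield_K)
  thus False using r_notin_L L.x_nonzero by simp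
qed

lemma quadext_L_M: "quadext (L n) (M (Suc n))"
  unfolding M_Suc by (rule quadextI[OF L.subfield_K ry_square_mem ry_notin_L])

text \<open>Together with \<open>r\<close> the field would contain \<open>y (Suc n)\<close> and
  hence equal \<open>L (Suc n)\<close>, which omits \<open>r\<close>.\<close>

lemma r_notin_M: "r \<notin> M (Suc n)"
proof
  assume r: "r \<in> M (Suc n)"
  have "r * y (Suc n) \<in> M (Suc n)" unfolding M_def by (rule adjoin_mem)
  hence "r * y (Suc n) / r \<in> M (Suc n)" using r by (intro subfield_divide subfield_M)
  hence "y (Suc n) \<in> M (Suc n)" using r_nonzero by simp
  hence "L (Suc n) \<subseteq> M (Suc n)" by (rule L.K_least[OF subfield_M])
  hence "L (Suc n) = L n \<or> L (Suc n) = M (Suc n)"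
    using quadext_between_cases[OF quadext_L_M L.subfield_K L.K_Suc_mono] by blast
  thus False using L_psubset[of n] r_notin_L[of "Suc n"] r by auto
qed

lemma M_subset_R: "M n \<subseteq> R n"
proof -
  have "r * y n \<in> R n" using r_mem_R L_subset_R[of n] L.x_mem_K[of n]
    by (intro subfield_mult subfield_R) auto
  thus ?thesis unfolding M_def by (intro adjoin_least subfield_R Rats_subset) auto
qed

lemma R_eq_M: "R (Suc n) = adjoin (M (Suc n)) {r}"
proof (rule equalityI)
  let ?A = "adjoin (M (Suc n)) {r}"
  have "r * y (Suc n) \<in> ?A" using adjoin_incl(1)[of "M (Suc n)" "{r}"] adjoin_mem[of _ \<rat>] by (auto simp: M_def)
  hence "r * y (Suc n) / r \<in> ?A" by (intro subfield_divide subfield_adjoin adjoin_mem)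
  hence "y (Suc n) \<in> ?A" using r_nonzero by simp
  hence "L (Suc n) \<subseteq> ?A" by (rule L.K_least[OF subfield_adjoin])
  thus "R (Suc n) \<subseteq> ?A" unfolding R_def using adjoin_mem by (intro adjoin_least subfield_adjoin) auto
  show "?A \<subseteq> R (Suc n)" using M_subset_R r_mem_R by (intro adjoin_least subfield_R) auto
qed

lemma quadext_M_R: "quadext (M (Suc n)) (R (Suc n))"
  unfolding R_eq_M by (rule quadextI[OF subfield_M r_square_mem[OF subfield_M] r_notin_M])

subsection \<open>Subfields of index two\<close>

text \<open>Telescoping of \<open>(2 + y (Suc m)) * (2 - y (Suc m)) = 2 - y m\<close>. As
  \<open>(y 1)\<^sup>2 = 2\<close>, it exhibits a square root of \<open>2 - y m\<close> as
  \<open>y 1\<close> divided by later generators.\<close>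

lemma y_prod: "(\<Prod>i<m. y (Suc (Suc i)))\<^sup>2 * (2 - y m) = 2"
proof (induction m)
  case (Suc m)
  let ?P = "\<Prod>i<m. y (Suc (Suc i))"
  have "(\<Prod>i<Suc m. y (Suc (Suc i)))\<^sup>2 * (2 - y (Suc m)) =
    ?P\<^sup>2 * ((y (Suc (Suc m)))\<^sup>2 * (2 - y (Suc m)))" by (simp add: power_mult_distrib mult.assoc)
  also have "(y (Suc (Suc m)))\<^sup>2 * (2 - y (Suc m)) = 4 - (y (Suc m))\<^sup>2"
    unfolding y_Suc[of "Suc m"] by (simp add: algebra_simps power2_eq_square)
  also have "\<dots> = 2 - y m" by (simp add: y_Suc)
  finally show ?case using Suc by simp
qed (simp add: y_0)

text \<open>If \<open>\<tau>\<close> first moves \<open>y\<^sub>k\<close>, then \<open>w \<tau> w\<close> is fixed, while up to sign it equals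
  \<open>c y\<^sub>1 / (y\<^sub>2 \<cdots> y\<^sub>k)\<close>, which \<open>\<tau>\<close> negates.\<close>

lemma involution_fixes_y:
  assumes \<tau>: "involution_on T \<tau>"
    and w: "w \<in> T" "w\<^sup>2 = c * (2 + y k)" "c \<in> \<rat>" "c \<noteq> 0"
  shows "y k \<in> fixed_field T \<tau>"
  using w
proof (induction k arbitrary: w c)
  case 0
  show ?case using subfield_0[OF subfield_fixed_field[OF \<tau>]] by (simp add: y_0)
next
  case (Suc m)
  let ?F = "fixed_field T \<tau>"
  note inv = involution_add[OF \<tau>] involution_mult[OF \<tau>] involution_mem[OF \<tau>]
    involution_invol[OF \<tau>] involution_Rats[OF \<tau>]
  have T: "subfield T CC" by (rule involution_subfield[OF \<tau>])
  have F: "subfield ?F CC" by (rule subfield_fixed_field[OF \<tau>])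
  have cT: "c \<in> T" using Suc.prems(3) subfield_Rats[OF T] by blast
  have "y (Suc m) = w\<^sup>2 / c - 2" using Suc.prems by simp
  hence yT: "y (Suc m) \<in> T" using Suc.prems(1) cT T by (simp add: subfield_closed)
  \<comment> \<open>The induction hypothesis with \<open>y (Suc m)\<close> as the root and
    \<open>c = 1\<close>.\<close>
  have "y m \<in> ?F" using Suc.IH[OF yT, of 1] y_Suc[of m] by simp
  hence LF: "L m \<subseteq> ?F" by (rule L.K_least[OF F])
  have "\<tau> ((y (Suc m))\<^sup>2) = (y (Suc m))\<^sup>2" using LF L.x_Suc_square_mem[of m] by (auto simp: fixed_field_def)
  hence "\<tau> (y (Suc m)) = y (Suc m) \<or> \<tau> (y (Suc m)) = - y (Suc m)" by (rule involution_sqrt[OF \<tau> yT])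
  moreover have False if neg: "\<tau> (y (Suc m)) = - y (Suc m)"
  proof -
    define b where "b = w * \<tau> w"
    have bF: "\<tau> b = b" "b \<in> T"
      using Suc.prems(1) T by (auto simp: b_def inv mult.commute subfield_mult)
    have "(\<tau> w)\<^sup>2 = \<tau> (c * (2 + y (Suc m)))" using involution_power[OF \<tau> Suc.prems(1), of 2] Suc.prems(2) by simp
    also have "\<dots> = c * (2 - y (Suc m))"
      using cT yT T neg Suc.prems(3) by (simp add: inv subfield_closed)
    finally have "b\<^sup>2 = c\<^sup>2 * ((2 + y (Suc m)) * (2 - y (Suc m)))"
      by (simp add: b_def power_mult_distrib Suc.prems(2)) (simp add: power2_eq_square)
    also have "(2 + y (Suc m)) * (2 - y (Suc m)) = 2 - y m"
      using y_Suc[of m] by (simp add: algebra_simps power2_eq_square)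
    finally have b2: "b\<^sup>2 = c\<^sup>2 * (2 - y m)" .
    define P where "P m = (\<Prod>i<m. y (Suc (Suc i)))" for m
    have "(b * P m)\<^sup>2 = c\<^sup>2 * ((P m)\<^sup>2 * (2 - y m))" by (simp add: power_mult_distrib b2 mult_ac)
    also have "\<dots> = (c * y 1)\<^sup>2" using y_Suc[of 0] y_0 y_prod[of m] by (simp add: P_def power_mult_distrib)
    finally obtain e where e: "e \<in> \<rat>" "e \<noteq> 0" "b * P m = e * y 1"
      using Suc.prems(3,4) by (metis Rats_minus_iff minus_mult_left neg_equal_0_iff_equal power2_eq_iff)
    have eT: "e \<in> T" "\<tau> e = e" using e(1) subfield_Rats[OF T] inv(5) by auto
    show False
    \<comment> \<open>For \<open>m = 0\<close> the product is empty and \<open>b\<close> is a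
      multiple of the negated \<open>y 1\<close>. For \<open>m > 0\<close> the last factor of
      \<open>P m\<close> is the negated \<open>y (Suc m)\<close>, while \<open>y 1\<close> and the
      other factors are fixed.\<close>
    proof (cases m)
      case 0
      hence "b = e * y (Suc m)" using e by (simp add: P_def)
      hence "\<tau> b = - b" using eT yT neg by (simp add: inv)
      hence "e * y (Suc m) = 0" using bF \<open>b = e * y (Suc m)\<close> by simp
      thus False using e(2) L.x_nonzero by simp
    next
      case (Suc q)
      have "P q \<in> L m" unfolding P_def by (intro subfield_prod L.subfield_K L.x_mem_K') (simp add: Suc)
      moreover have "y 1 \<in> L m" by (rule L.x_mem_K') (simp add: Suc)
      ultimately have fx: "\<tau> (P q) = P q" "P q \<in> T" "\<tau> (y 1) = y 1" "y 1 \<in> T"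
        using LF by (auto simp: fixed_field_def)
      have Pm: "P m = P q * y (Suc m)" by (simp add: P_def Suc)
      have "\<tau> (b * P m) = - (b * P m)"
        unfolding Pm using bF fx yT neg T by (simp add: inv subfield_mult)
      moreover have "\<tau> (b * P m) = b * P m" unfolding e(3) using eT fx by (simp only: inv)
      ultimately have "b * P m = 0" by simp
      thus False using e(2,3) L.x_nonzero[of 0] by simp
    qed
  qed
  ultimately show ?case using yT by (auto simp: fixed_field_def)
qed

text \<open>Used with \<open>w = y (Suc k)\<close>, \<open>c = 1\<close> and with
  \<open>w = r * y (Suc k)\<close>, \<open>c = 3\<close>.\<close>

lemma quadext_contains_L:
  assumes "quadext E T" "w \<in> T" "w\<^sup>2 = c * (2 + y k)" "c \<in> \<rat>" "c \<noteq> 0"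
  shows "L k \<subseteq> E"
proof -
  obtain \<tau> where \<tau>: "involution_on T \<tau>" "fixed_field T \<tau> = E" using quadext_involution[OF assms(1)] .
  show ?thesis using L.K_least[OF quadext_subfield(1)[OF assms(1)]]
    involution_fixes_y[OF \<tau>(1) assms(2-5)] \<tau>(2) by simp
qed

lemma index_two_L:
  assumes "quadext E (L (Suc n))"
  shows "E = L n"
proof -
  have "L n \<subseteq> E"
    using quadext_contains_L[OF assms L.x_mem_K, of 1] y_Suc[of n] by simp
  thus ?thesis using quadext_between_cases[OF L.quadext_K quadext_subfield(1)[OF assms]]
    quadext_psubset[OF assms] by auto
qed

lemma index_two_M:
  assumes "quadext E (M (Suc n))"
  shows "E = L n"
proof -
  have "r * y (Suc n) \<in> M (Suc n)" unfolding M_def by (rule adjoin_mem)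
  hence "L n \<subseteq> E"
    using quadext_contains_L[OF assms _ ry_square] by simp
  thus ?thesis using quadext_between_cases[OF quadext_L_M quadext_subfield(1)[OF assms]]
    quadext_psubset[OF assms] by auto
qed

lemma index_two_R_0:
  assumes "quadext E (R 0)"
  shows "E = \<rat>"
  using quadext_between_cases[OF quadext_L_R[of 0] quadext_subfield(1)[OF assms]] L.K_0
    Rats_subset[OF quadext_subfield(1)[OF assms]] quadext_psubset[OF assms] by auto

text \<open>The involution fixes \<open>L n\<close> and acts by signs on \<open>y (Suc n)\<close>
  and \<open>r\<close>, so it fixes one of them or their product, and that element generates an
  index-two subfield over \<open>L n\<close>.\<close>

lemma index_two_R_Suc:
  assumes E: "quadext E (R (Suc n))"
  shows "E = L (Suc n) \<or> E = R n \<or> E = M (Suc n)"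
proof -
  have sE: "subfield E CC" and pE: "E \<subset> R (Suc n)"
    using quadext_subfield(1)[OF E] quadext_psubset[OF E] by auto
  obtain \<tau> where \<tau>: "involution_on (R (Suc n)) \<tau>" "fixed_field (R (Suc n)) \<tau> = E"
    using quadext_involution[OF E] .
  have yR: "y (Suc n) \<in> R (Suc n)" using L.x_mem_K L_subset_R by blast
  have LE: "L n \<subseteq> E" using quadext_contains_L[OF E yR, of 1] y_Suc[of n] by simp
  have "(y (Suc n))\<^sup>2 \<in> E" using LE L.x_Suc_square_mem by blast
  hence ty: "\<tau> (y (Suc n)) = y (Suc n) \<or> \<tau> (y (Suc n)) = - y (Suc n)"
    using \<tau>(2) by (intro involution_sqrt[OF \<tau>(1) yR]) (auto simp: fixed_field_def)
  have tr: "\<tau> r = r \<or> \<tau> r = - r"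
    using r_square_mem[OF sE] \<tau>(2) by (intro involution_sqrt[OF \<tau>(1) r_mem_R]) (auto simp: fixed_field_def)
  consider "y (Suc n) \<in> E" | "r \<in> E" | "r * y (Suc n) \<in> E"
    using ty tr \<tau> yR r_mem_R[of "Suc n"] subfield_R
    by (auto simp: fixed_field_def involution_mult[OF \<tau>(1)] subfield_mult)
  thus ?thesis
  proof cases
    case 1
    hence "L (Suc n) \<subseteq> E" by (rule L.K_least[OF sE])
    thus ?thesis using quadext_between_cases[OF quadext_L_R sE] pE by auto
  next
    case 2
    hence "R n \<subseteq> E" unfolding R_def using LE by (intro adjoin_least sE) auto
    thus ?thesis using quadext_between_cases[OF quadext_R sE] pE by auto
  next
    case 3
    hence "M (Suc n) \<subseteq> E" unfolding M_def by (intro adjoin_least sE Rats_subset) auto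
    thus ?thesis using quadext_between_cases[OF quadext_M_R sE] pE by auto
  qed
qed

lemma qtower_R: "qtower (R n)"
  unfolding R_def by (rule qtower_adjoin[OF L.qtower_K r_square_mem[OF L.subfield_K]])

lemma qtower_M: "qtower (M (Suc n))"
  unfolding M_Suc by (rule qtower_adjoin[OF L.qtower_K ry_square_mem])

end

subsection \<open>The lattice of subfields\<close>

lemma UN_atLeast_1: "(\<Union>n\<in>{1..}. A n) = (\<Union>n. A (Suc n))"
proof -
  have "{1..} = range Suc" by (auto simp: image_iff) (metis Suc_le_D)
  thus ?thesis by simp
qed

context double_tower
begin

definition Linf :: "complex set" where "Linf = (\<Union>n. L n)"

definition Xinf :: "complex set" where "Xinf = (\<Union>n. X.K n)"

lemma Xinf_eq_Union_R: "Xinf = (\<Union>n. R n)"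
proof -
  have "X.K n \<subseteq> R n" for n using X.K_Suc_mono[of n] by (simp add: XK_Suc_eq_R)
  moreover have "R n \<subseteq> Xinf" for n unfolding Xinf_def XK_Suc_eq_R[symmetric] by blast
  ultimately show ?thesis unfolding Xinf_def by blast
qed

lemma subfield_Linf: "subfield Linf CC"
  unfolding Linf_def by (rule subfield_directed_Union[OF L.K_mono L.subfield_K])

lemma subfield_Xinf: "subfield Xinf CC"
  unfolding Xinf_def by (rule subfield_directed_Union[OF X.K_mono X.subfield_K])

lemma L_subset_Linf: "L n \<subseteq> Linf" and R_subset_Xinf: "R n \<subseteq> Xinf"
  unfolding Linf_def Xinf_eq_Union_R by blast+

lemma Linf_subset_Xinf: "Linf \<subseteq> Xinf"
  unfolding Linf_def Xinf_eq_Union_R using L_subset_R by blast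

lemma r_notin_Linf: "r \<notin> Linf"
  unfolding Linf_def using r_notin_L by blast

lemma r_mem_Xinf: "r \<in> Xinf"
  using r_mem_R R_subset_Xinf by blast

lemma Xinf_eq_adjoin: "Xinf = adjoin Linf {r}"
proof (rule equalityI)
  have "R n \<subseteq> adjoin Linf {r}" for n
    unfolding R_def
    by (rule adjoin_least[OF subfield_adjoin subset_trans[OF L_subset_Linf adjoin_incl(1)] adjoin_incl(2)])
  thus "Xinf \<subseteq> adjoin Linf {r}" unfolding Xinf_eq_Union_R by blast
  show "adjoin Linf {r} \<subseteq> Xinf"
    using Linf_subset_Xinf r_mem_Xinf by (intro adjoin_least subfield_Xinf) auto
qed

lemma quadext_Linf_Xinf: "quadext Linf Xinf"
  unfolding Xinf_eq_adjoin by (rule quadextI[OF subfield_Linf r_square_mem[OF subfield_Linf] r_notin_Linf])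

lemma subfield_of_L:
  assumes "subfield F CC" "F \<subseteq> L n"
  shows "\<exists>j. F = L j"
  using assms
proof (induction n)
  case 0
  hence "F = L 0" using Rats_subset[of F] L.K_0 by auto
  thus ?case by blast
next
  case (Suc n)
  show ?case
  proof (cases "F = L (Suc n)")
    case False
    then obtain E where E: "F \<subseteq> E" "quadext E (L (Suc n))"
      using qtower_maximal_subfield[OF L.qtower_K Suc.prems(1)] Suc.prems(2) by blast
    thus ?thesis using Suc index_two_L[OF E(2)] by blast
  qed blast
qed

text \<open>The subfields of finite degree. The rationals occur as \<open>L 0\<close>; since
  \<open>y 0 = 0\<close>, the fields \<open>M\<close> start at index 1.\<close>

definition standard :: "complex set \<Rightarrow> bool" where
  "standard F \<longleftrightarrow> (\<exists>j. F = L j) \<or> (\<exists>j. F = R j) \<or> (\<exists>j. F = M (Suc j))"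

lemma subfield_of_M:
  assumes "subfield F CC" "F \<subseteq> M (Suc n)"
  shows "standard F"
proof (cases "F = M (Suc n)")
  case False
  then obtain E where E: "F \<subseteq> E" "quadext E (M (Suc n))"
    using qtower_maximal_subfield[OF qtower_M assms(1)] assms(2) by blast
  thus ?thesis using subfield_of_L[OF assms(1)] index_two_M[OF E(2)] by (auto simp: standard_def)
qed (auto simp: standard_def)

lemma subfield_of_R:
  assumes "subfield F CC" "F \<subseteq> R n"
  shows "standard F"
  using assms(2)
proof (induction n)
  case 0
  show ?case
  proof (cases "F = R 0")
    case False
    then obtain E where E: "F \<subseteq> E" "quadext E (R 0)"
      using qtower_maximal_subfield[OF qtower_R assms(1)] 0 by blast
    thus ?thesis
      using subfield_of_L[OF assms(1), of 0] index_two_R_0[OF E(2)] L.K_0 by (auto simp: standard_def)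
  qed (auto simp: standard_def)
next
  case (Suc n)
  show ?case
  proof (cases "F = R (Suc n)")
    case False
    then obtain E where E: "F \<subseteq> E" "quadext E (R (Suc n))"
      using qtower_maximal_subfield[OF qtower_R assms(1)] Suc.prems by blast
    from index_two_R_Suc[OF E(2)] show ?thesis
      using subfield_of_L[OF assms(1), of "Suc n"] subfield_of_M[OF assms(1), of n] Suc.IH E(1)
      by (auto simp: standard_def)
  qed (auto simp: standard_def)
qed

lemma standard_subset_R:
  assumes "standard F"
  shows "\<exists>n. F \<subseteq> R n"
  using assms L_subset_R M_subset_R unfolding standard_def by blast

lemma standard_imp_subfield: "standard F \<Longrightarrow> subfield F CC"
  using L.subfield_K subfield_R subfield_M by (auto simp: standard_def)

text \<open>A standard field of low level would lie inside \<open>R n\<close>; a higher one contains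
  \<open>L n\<close>, because \<open>L j\<close> lies in both \<open>R j\<close> and
  \<open>M (Suc j)\<close>.\<close>

lemma standard_contains_L:
  assumes "standard F" "\<not> F \<subseteq> R n"
  shows "L n \<subseteq> F"
proof -
  consider j where "F = L j" | j where "F = R j" | j where "F = M (Suc j)"
    using assms(1) unfolding standard_def by blast
  thus ?thesis
  proof cases
    case (1 j)
    have "n \<le> j"
      using assms(2) 1 R_mono[of j n] L_subset_R[of j] by (metis linorder_linear subset_trans)
    thus ?thesis using 1 L.K_mono by simp
  next
    case (2 j)
    have "n \<le> j" using assms(2) 2 R_mono[of j n] by (metis linorder_linear)
    thus ?thesis using 2 R_mono[of n j] L_subset_R[of n] by simp
  next
    case (3 j)
    have "n < Suc j"
      using assms(2) 3 R_mono[of "Suc j" n] M_subset_R[of "Suc j"] by (metis not_le subset_trans)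
    thus ?thesis using 3 L.K_mono[of n j] L_subset_M[of j] by simp
  qed
qed

text \<open>If \<open>F\<close> lies in no \<open>R n\<close>, then for each \<open>n\<close> some
  \<open>F \<inter> R m\<close> is standard and not inside \<open>R n\<close>, hence contains
  \<open>L n\<close>. So \<open>F\<close> contains \<open>Linf\<close>, over which
  \<open>Xinf\<close> is quadratic.\<close>

lemma subfield_of_Xinf:
  assumes F: "subfield F CC" "F \<subseteq> Xinf"
  shows "standard F \<or> F = Linf \<or> F = Xinf"
proof (cases "\<exists>n. F \<subseteq> R n")
  case True
  thus ?thesis using subfield_of_R[OF F(1)] by blast
next
  case False
  have "L n \<subseteq> F" for n
  proof -
    obtain a where a: "a \<in> F" "a \<notin> R n" using False by blast
    then obtain m where m: "a \<in> R m" using F(2) unfolding Xinf_eq_Union_R by blast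
    have "standard (F \<inter> R m)" by (rule subfield_of_R[OF subfield_Int[OF F(1) subfield_R]]) blast
    moreover have "\<not> F \<inter> R m \<subseteq> R n" using a m by blast
    ultimately show ?thesis using standard_contains_L by blast
  qed
  hence "Linf \<subseteq> F" unfolding Linf_def by blast
  thus ?thesis using quadext_between_cases[OF quadext_Linf_Xinf F(1)] F(2) by blast
qed

lemma standard_cases:
  assumes "standard F"
  obtains (Rats) "F = \<rat>" | (L) n where "F = L (Suc n)" | (R) n where "F = R n" | (M) n where "F = M (Suc n)"
proof -
  consider j where "F = L j" | j where "F = R j" | j where "F = M (Suc j)"
    using assms unfolding standard_def by blast
  thus ?thesis
  proof cases
    case (1 j)
    thus ?thesis using Rats L L.K_0 by (cases j) auto
  qed (use R M in blast)+
qed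

lemma Rats_standard: "standard \<rat>"
  unfolding standard_def using L.K_0 by metis

lemma standard_intros: "standard (L n)" "standard (R n)" "standard (M (Suc n))"
  unfolding standard_def by blast+

section \<open>Degrees and inclusions of degree two\<close>

lemma has_degree_R: "has_degree (R n) \<rat> (2 ^ Suc n)"
  using has_degree_quadext_step[OF subfield_Rats_CC L.has_degree_K quadext_L_R] by simp

lemma has_degree_M: "has_degree (M (Suc n)) \<rat> (2 ^ Suc n)"
  using has_degree_quadext_step[OF subfield_Rats_CC L.has_degree_K quadext_L_M] by simp

text \<open>Degree \<open>d\<close> is impossible because \<open>L d\<close> already has degree
  \<open>2 ^ d > d\<close>.\<close>

lemma infinite_degree_Linf_subset:
  assumes "Linf \<subseteq> F"
  shows "infinite_degree F \<rat>"
proof -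
  have "\<not> has_degree F \<rat> d" for d
  proof
    assume "has_degree F \<rat> d"
    hence "2 ^ d \<le> d"
      using has_degree_mono[OF subfield_Rats_CC L.has_degree_K] assms L_subset_Linf by blast
    thus False using less_exp[of d] by linarith
  qed
  moreover have "\<rat> \<subseteq> F" using assms Rats_subset[OF subfield_Linf] by blast
  ultimately show ?thesis unfolding infinite_degree_def by blast
qed

lemma standard_finite_degree: "standard F \<Longrightarrow> \<not> infinite_degree F \<rat>"
  unfolding infinite_degree_def standard_def using L.has_degree_K has_degree_R has_degree_M by blast

lemma infinite_degree_proper_subfields:
  "{F \<in> proper_subfields_of Xinf. infinite_degree F \<rat>} = {Linf}"
proof (intro equalityI subsetI)
  fix F assume "F \<in> {F \<in> proper_subfields_of Xinf. infinite_degree F \<rat>}"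
  hence F: "subfield F CC" "F \<subset> Xinf" "infinite_degree F \<rat>" by (auto simp: proper_subfields_of_def)
  thus "F \<in> {Linf}" using subfield_of_Xinf[OF F(1)] standard_finite_degree by blast
next
  fix F assume "F \<in> {Linf}"
  thus "F \<in> {F \<in> proper_subfields_of Xinf. infinite_degree F \<rat>}"
    using subfield_Linf quadext_psubset[OF quadext_Linf_Xinf] infinite_degree_Linf_subset
    by (simp add: proper_subfields_of_def)
qed

lemma distinct_level: "L (Suc n) \<noteq> R n" "L (Suc n) \<noteq> M (Suc n)" "R n \<noteq> M (Suc n)"
  using r_mem_R[of n] r_notin_L[of "Suc n"] r_notin_M[of n] ry_notin_L[of n "Suc n"]
    adjoin_mem[of "r * y (Suc n)" \<rat>] by (auto simp: M_def)

lemma subfields_of_Xinf_iff: "F \<in> subfields_of Xinf \<longleftrightarrow> standard F \<or> F = Linf \<or> F = Xinf"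
proof
  assume "F \<in> subfields_of Xinf"
  thus "standard F \<or> F = Linf \<or> F = Xinf" using subfield_of_Xinf by (simp add: subfields_of_def)
next
  assume "standard F \<or> F = Linf \<or> F = Xinf"
  thus "F \<in> subfields_of Xinf"
    using standard_imp_subfield standard_subset_R[of F] R_subset_Xinf subfield_Linf Linf_subset_Xinf
      subfield_Xinf unfolding subfields_of_def by blast
qed

lemma subfields_of_Xinf:
  "subfields_of Xinf = {\<rat>, Linf, Xinf} \<union> (\<Union>n\<in>{1..}. {L n, X.K n, M n})"
  unfolding UN_atLeast_1 XK_Suc_eq_R
proof (intro equalityI subsetI)
  fix F assume "F \<in> subfields_of Xinf"
  thus "F \<in> {\<rat>, Linf, Xinf} \<union> (\<Union>n. {L (Suc n), R n, M (Suc n)})"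
    unfolding subfields_of_Xinf_iff by (auto elim: standard_cases)
next
  fix F assume "F \<in> {\<rat>, Linf, Xinf} \<union> (\<Union>n. {L (Suc n), R n, M (Suc n)})"
  thus "F \<in> subfields_of Xinf"
    unfolding subfields_of_Xinf_iff using Rats_standard standard_intros by auto
qed

lemma subfields_of_degree:
  "{F \<in> subfields_of Xinf. has_degree F \<rat> (2 ^ Suc n)} = {L (Suc n), R n, M (Suc n)}"
proof (intro equalityI subsetI)
  fix F assume "F \<in> {F \<in> subfields_of Xinf. has_degree F \<rat> (2 ^ Suc n)}"
  hence F: "standard F \<or> F = Linf \<or> F = Xinf" and deg: "has_degree F \<rat> (2 ^ Suc n)"
    by (auto simp: subfields_of_Xinf_iff)
  have "standard F"
    using F deg infinite_degree_Linf_subset[of F] Linf_subset_Xinf unfolding infinite_degree_def by blast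
  \<comment> \<open>Uniqueness of the degree determines the level of a standard field.\<close>
  have pow: "has_degree F \<rat> (2 ^ m) \<Longrightarrow> m = Suc n" for m
    using has_degree_unique[OF subfield_Rats_CC deg, of "2 ^ m"] by (simp del: power_Suc)
  from \<open>standard F\<close> show "F \<in> {L (Suc n), R n, M (Suc n)}"
  proof (cases rule: standard_cases)
    case Rats
    thus ?thesis using pow[of 0] has_degree_self[OF subfield_Rats_CC] by simp
  next
    case (L m)
    thus ?thesis using pow[of "Suc m"] L.has_degree_K[of "Suc m"] by simp
  next
    case (R m)
    thus ?thesis using pow[of "Suc m"] has_degree_R[of m] by simp
  next
    case (M m)
    thus ?thesis using pow[of "Suc m"] has_degree_M[of m] by simp
  qed
next
  fix F assume "F \<in> {L (Suc n), R n, M (Suc n)}"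
  thus "F \<in> {F \<in> subfields_of Xinf. has_degree F \<rat> (2 ^ Suc n)}"
    using L.has_degree_K has_degree_R has_degree_M standard_intros subfields_of_Xinf_iff by blast
qed

text \<open>Two successive levels would lie between \<open>F\<close> and the union without reaching
  it, so both would equal \<open>F\<close>.\<close>

lemma not_quadext_Union:
  assumes psub: "\<And>n. A n \<subset> A (Suc n)" and A: "\<And>n. subfield (A n) CC" and F: "F \<subseteq> A n"
  shows "\<not> quadext F (\<Union>n. A n)"
proof
  assume q: "quadext F (\<Union>n. A n)"
  have ne: "A m \<noteq> (\<Union>n. A n)" for m using psub[of m] by blast
  have "F \<subseteq> A (Suc n)" using F psub[of n] by blast
  hence "A n = F" "A (Suc n) = F"
    using quadext_between_cases[OF q A] F ne by blast+
  thus False using psub[of n] by simp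
qed

text \<open>Cases on the upper field. A standard one is settled by the index-two lemmas; an infinite
  union is not quadratic over a subfield of one of its levels, which leaves only \<open>Linf\<close>
  below \<open>Xinf\<close>.\<close>

lemma quadext_pairs:
  assumes "standard F \<or> F = Linf \<or> F = Xinf" "standard E \<or> E = Linf \<or> E = Xinf" "quadext F E"
  shows "(\<exists>n. F = L n \<and> (E = L (Suc n) \<or> E = M (Suc n) \<or> E = R n)) \<or>
    (\<exists>n. E = R (Suc n) \<and> (F = R n \<or> F = M (Suc n))) \<or> F = Linf \<and> E = Xinf"
proof -
  have sF: "subfield F CC" and FE: "F \<subset> E"
    using quadext_subfield[OF assms(3)] quadext_psubset[OF assms(3)] by auto
  consider "standard E" | "E = Linf" | "E = Xinf" using assms(2) by blast
  thus ?thesis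
  proof cases
    case 1
    thus ?thesis
    proof (cases rule: standard_cases)
      case Rats
      thus ?thesis using FE Rats_subset[OF sF] by blast
    next
      case (L n)
      thus ?thesis using index_two_L assms(3) by blast
    next
      case (R n)
      show ?thesis
      proof (cases n)
        case 0
        thus ?thesis using R index_two_R_0[of F] assms(3) L.K_0 by blast
      next
        case (Suc m)
        thus ?thesis using R index_two_R_Suc[of F m] assms(3) by blast
      qed
    next
      case (M n)
      thus ?thesis using index_two_M assms(3) by blast
    qed
  next
    case 2
    have F: "F \<subset> Linf" using FE 2 by simp
    hence "standard F" using assms(1) Linf_subset_Xinf by blast
    hence "\<exists>n. F \<subseteq> L n"
    proof (cases rule: standard_cases)
      case Rats
      thus ?thesis using L.K_0 by blast
    next
      case (R n)
      thus ?thesis using F r_mem_R[of n] r_notin_Linf by blast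
    next
      case (M n)
      have "r * y (Suc n) \<in> Linf" using F M adjoin_mem[of "r * y (Suc n)" \<rat>] by (auto simp: M_def)
      thus ?thesis using ry_notin_L unfolding Linf_def by blast
    qed blast
    thus ?thesis
      using not_quadext_Union[of L F, OF L_psubset L.subfield_K] assms(3) 2 unfolding Linf_def by blast
  next
    case 3
    have "\<not> standard F"
      using standard_subset_R[of F] not_quadext_Union[of R F, OF quadext_psubset[OF quadext_R] subfield_R]
        assms(3) 3 unfolding Xinf_eq_Union_R by blast
    thus ?thesis using assms(1) FE 3 by blast
  qed
qed

lemma degree_two_pairs:
  "{(F, E). F \<in> subfields_of Xinf \<and> E \<in> subfields_of Xinf \<and> has_degree E F 2} =
    {(\<rat>, L 1), (\<rat>, X.K 1), (\<rat>, M 1), (Linf, Xinf)} \<union>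
    (\<Union>n\<in>{1..}. {(L n, L (n + 1)), (L n, M (n + 1)), (L n, X.K (n + 1)), (M n, X.K (n + 1)),
      (X.K n, X.K (n + 1))})"
  (is "?A = ?B")
proof -
  \<comment> \<open>The pairs above \<open>L 0\<close>, which is the field of rationals, are
    separated; elsewhere indices shift by one because \<open>R n\<close> is
    \<open>X.K (Suc n)\<close>.\<close>
  let ?S = "{(L 0, L (Suc 0)), (L 0, R 0), (L 0, M (Suc 0)), (Linf, Xinf)}"
  let ?T = "\<lambda>n. {(L (Suc n), L (Suc (Suc n))), (L (Suc n), M (Suc (Suc n))), (L (Suc n), R (Suc n)),
    (M (Suc n), R (Suc n)), (R n, R (Suc n))}"
  have B: "?B = ?S \<union> (\<Union>n. ?T n)"
    unfolding UN_atLeast_1 by (simp add: XK_Suc_eq_R L.K_0)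
  have sf: "subfield F CC" if "F \<in> subfields_of Xinf" for F using that by (simp add: subfields_of_def)
  show ?thesis unfolding B
  proof (intro equalityI subrelI)
    fix F E assume "(F, E) \<in> ?A"
    hence *: "F \<in> subfields_of Xinf" "E \<in> subfields_of Xinf" "quadext F E"
      using has_degree_quadext sf by auto
    consider n where "F = L n" "E = L (Suc n) \<or> E = M (Suc n) \<or> E = R n"
      | n where "E = R (Suc n)" "F = R n \<or> F = M (Suc n)" | "F = Linf" "E = Xinf"
      using quadext_pairs[of F E] * unfolding subfields_of_Xinf_iff by blast
    thus "(F, E) \<in> ?S \<union> (\<Union>n. ?T n)"
    proof cases
      case (1 n)
      show ?thesis
      proof (cases n)
        case 0
        hence "(F, E) \<in> ?S" using 1 by blast
        thus ?thesis by (rule UnI1)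
      next
        case (Suc m)
        hence "(F, E) \<in> ?T m" using 1 by blast
        thus ?thesis by (intro UnI2 UN_I[OF UNIV_I])
      qed
    next
      case (2 n)
      hence "(F, E) \<in> ?T n" by blast
      thus ?thesis by (intro UnI2 UN_I[OF UNIV_I])
    next
      case 3
      hence "(F, E) \<in> ?S" by blast
      thus ?thesis by (rule UnI1)
    qed
  next
    fix F E assume "(F, E) \<in> ?S \<union> (\<Union>n. ?T n)"
    hence "(F, E) \<in> ?S \<or> (\<exists>n. (F, E) \<in> ?T n)" by (simp only: Un_iff UN_iff bex_UNIV)
    hence "quadext F E \<and> (standard F \<or> F = Linf) \<and> (standard E \<or> E = Xinf)"
      by (elim disjE exE; elim insertE emptyE)
         (simp_all add: L.quadext_K quadext_L_R quadext_L_M quadext_M_R quadext_R quadext_Linf_Xinf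
           standard_intros)
    thus "(F, E) \<in> ?A" using quadext_has_degree subfields_of_Xinf_iff by auto
  qed
qed

text \<open>The larger field contains \<open>L (Suc n)\<close>, hence \<open>y (Suc n)\<close>; with
  \<open>r * y (Suc n)\<close> it would also contain \<open>r\<close>.\<close>

lemma M_not_subset: "\<not> M (Suc n) \<subseteq> M (Suc (Suc n))"
proof
  assume "M (Suc n) \<subseteq> M (Suc (Suc n))"
  hence "r * y (Suc n) \<in> M (Suc (Suc n))" using adjoin_mem[of "r * y (Suc n)" \<rat>] by (auto simp: M_def)
  moreover have "y (Suc n) \<in> M (Suc (Suc n))" using L_subset_M L.x_mem_K by blast
  ultimately have "r * y (Suc n) / y (Suc n) \<in> M (Suc (Suc n))" by (intro subfield_divide subfield_M)
  thus False using r_notin_M L.x_nonzero by simp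
qed

end

section \<open>Assembly of the statements for \<open>Kn\<close> and \<open>Kinf\<close>\<close>

lemma Omega_square_subfields:
  fixes a :: int
  assumes "(\<nu>, x0) \<in> Omega" "u \<nu> 0 - x0 = a\<^sup>2" "\<nu> \<ge> 3"
  shows "proper_subfields_of (Kinf \<nu> x0 s) =
      range (Kn \<nu> x0 s) \<union> {adjoin \<rat> {sqrtC (2 * (\<nu> - a))}, adjoin \<rat> {sqrtC (2 * (\<nu> + a))}} \<and>
    has_degree (adjoin \<rat> {sqrtC (2 * (\<nu> - a))}) \<rat> 2 \<and>
    has_degree (adjoin \<rat> {sqrtC (2 * (\<nu> + a))}) \<rat> 2 \<and>
    adjoin \<rat> {sqrtC (2 * (\<nu> - a))} \<noteq> adjoin \<rat> {sqrtC (2 * (\<nu> + a))} \<and>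
    adjoin \<rat> {sqrtC (2 * (\<nu> - a))} \<notin> range (Kn \<nu> x0 s) \<and>
    adjoin \<rat> {sqrtC (2 * (\<nu> + a))} \<notin> range (Kn \<nu> x0 s) \<and>
    adjoin \<rat> {sqrtC (2 * (\<nu> - a))} \<subseteq> Kn \<nu> x0 s 2 \<and>
    adjoin \<rat> {sqrtC (2 * (\<nu> + a))} \<subseteq> Kn \<nu> x0 s 2"
proof -
  interpret square_sqrt_tower \<nu> x0 "xseq \<nu> x0 s" a
    by (rule Omega_square_sqrt_tower[OF assms(1,3,2)])
  have K: "K = Kn \<nu> x0 s" by (rule tower_K_xseq)
  have W: "adjoin \<rat> {sqrtC (2 * (\<nu> + a))} = W a" "adjoin \<rat> {sqrtC (2 * (\<nu> - a))} = W (- a)"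
    using W_eq_sqrtC[of a] W_eq_sqrtC[of "- a"] by auto
  show ?thesis
    unfolding W Kinf_def K[symmetric]
    by (intro conjI proper_subfields_square quadext_has_degree quadext_W W_neq[symmetric]
        W_notin_range W_subset_K2) auto
qed

lemma double_tower_xseq: "double_tower (xseq 2 0 s) (xseq 2 1 t)"
  by (intro double_tower.intro sqrt_tower_2_0_rigid sqrt_tower_xseq)

lemma subfields_2_1:
  "{F \<in> proper_subfields_of (Kinf 2 1 t). infinite_degree F \<rat>} = {Kinf 2 0 s} \<and>
   Kinf 2 1 t = adjoin (Kinf 2 0 s) {sqrtC 3} \<and>
   (\<forall>n\<ge>1. Kn 2 1 t (n + 1) = adjoin (Kn 2 0 s n) {sqrtC 3} \<and>
           Kn 2 0 s n \<noteq> Kn 2 1 t (n + 1)) \<and>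
   subfields_of (Kinf 2 1 t) =
     {\<rat>, Kinf 2 0 s, Kinf 2 1 t} \<union> (\<Union>n\<in>{1..}. {Kn 2 0 s n, Kn 2 1 t n, Mn s n}) \<and>
   (\<forall>n\<ge>1. distinct [Kn 2 0 s n, Kn 2 1 t n, Mn s n] \<and>
           {F \<in> subfields_of (Kinf 2 1 t). has_degree F \<rat> (2 ^ n)} =
             {Kn 2 0 s n, Kn 2 1 t n, Mn s n}) \<and>
   {(F, E). F \<in> subfields_of (Kinf 2 1 t) \<and> E \<in> subfields_of (Kinf 2 1 t) \<and> has_degree E F 2} =
     {(\<rat>, Kn 2 0 s 1), (\<rat>, Kn 2 1 t 1), (\<rat>, Mn s 1), (Kinf 2 0 s, Kinf 2 1 t)} \<union>
     (\<Union>n\<in>{1..}. {(Kn 2 0 s n, Kn 2 0 s (n + 1)), (Kn 2 0 s n, Mn s (n + 1)),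
                   (Kn 2 0 s n, Kn 2 1 t (n + 1)), (Mn s n, Kn 2 1 t (n + 1)),
                   (Kn 2 1 t n, Kn 2 1 t (n + 1))}) \<and>
   (\<forall>n\<ge>1. \<not> Mn s n \<subseteq> Mn s (n + 1))"
proof -
  interpret double_tower "xseq 2 0 s" "xseq 2 1 t" by (rule double_tower_xseq)
  have eqs: "Kn 2 0 s = L" "Kn 2 1 t = X.K" "Mn s = M" "Kinf 2 0 s = Linf" "Kinf 2 1 t = Xinf"
    by (auto simp: tower_K_xseq Linf_def Xinf_def Kinf_def Mn_def M_def fun_eq_iff)
  have "X.K (n + 1) = adjoin (L n) {r} \<and> L n \<noteq> X.K (n + 1)" for n
    using quadext_psubset[OF quadext_L_R[of n]] by (simp add: XK_Suc_eq_R R_def)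
  moreover have "distinct [L n, X.K n, M n] \<and>
      {F \<in> subfields_of Xinf. has_degree F \<rat> (2 ^ n)} = {L n, X.K n, M n}" if n: "n \<ge> 1" for n
  proof -
    obtain m where "n = Suc m" using n by (cases n) auto
    thus ?thesis using distinct_level[of m] subfields_of_degree[of m] by (simp add: XK_Suc_eq_R)
  qed
  moreover have "\<not> M n \<subseteq> M (n + 1)" if "n \<ge> 1" for n
    using that M_not_subset[of "n - 1"] by simp
  ultimately show ?thesis
    unfolding eqs
    using infinite_degree_proper_subfields Xinf_eq_adjoin subfields_of_Xinf degree_two_pairs by blast
qed

theorem theorem1p4:
  shows
    \<comment> \<open>(1)\<close>
    "(\<forall>\<nu> x0 s. (\<nu>, x0) \<in> Omega \<longrightarrow> (\<nexists>a::int. u \<nu> 0 - x0 = a\<^sup>2) \<longrightarrow>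
        proper_subfields_of (Kinf \<nu> x0 s) = range (Kn \<nu> x0 s))
    \<and>
     (\<forall>\<nu> x0 s (a::int). (\<nu>, x0) \<in> Omega \<longrightarrow> u \<nu> 0 - x0 = a\<^sup>2 \<longrightarrow> \<nu> \<ge> 3 \<longrightarrow>
        proper_subfields_of (Kinf \<nu> x0 s) =
          range (Kn \<nu> x0 s) \<union> {adjoin \<rat> {sqrtC (2 * (\<nu> - a))}, adjoin \<rat> {sqrtC (2 * (\<nu> + a))}} \<and>
        has_degree (adjoin \<rat> {sqrtC (2 * (\<nu> - a))}) \<rat> 2 \<and>
        has_degree (adjoin \<rat> {sqrtC (2 * (\<nu> + a))}) \<rat> 2 \<and>
        adjoin \<rat> {sqrtC (2 * (\<nu> - a))} \<noteq> adjoin \<rat> {sqrtC (2 * (\<nu> + a))} \<and>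
        adjoin \<rat> {sqrtC (2 * (\<nu> - a))} \<notin> range (Kn \<nu> x0 s) \<and>
        adjoin \<rat> {sqrtC (2 * (\<nu> + a))} \<notin> range (Kn \<nu> x0 s) \<and>
        adjoin \<rat> {sqrtC (2 * (\<nu> - a))} \<subseteq> Kn \<nu> x0 s 2 \<and>
        adjoin \<rat> {sqrtC (2 * (\<nu> + a))} \<subseteq> Kn \<nu> x0 s 2)
    \<and>
     infinite {(\<nu>, x0). (\<nu>, x0) \<in> Omega \<and> \<nu> \<ge> 3 \<and> (\<exists>a::int. u \<nu> 0 - x0 = a\<^sup>2)}
    \<and>
     (\<forall>s t.
        {F \<in> proper_subfields_of (Kinf 2 1 t). infinite_degree F \<rat>} = {Kinf 2 0 s} \<and>
        Kinf 2 1 t = adjoin (Kinf 2 0 s) {sqrtC 3} \<and>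
        (\<forall>n\<ge>1. Kn 2 1 t (n + 1) = adjoin (Kn 2 0 s n) {sqrtC 3} \<and>
                Kn 2 0 s n \<noteq> Kn 2 1 t (n + 1)) \<and>
        subfields_of (Kinf 2 1 t) =
          {\<rat>, Kinf 2 0 s, Kinf 2 1 t} \<union> (\<Union>n\<in>{1..}. {Kn 2 0 s n, Kn 2 1 t n, Mn s n}) \<and>
        (\<forall>n\<ge>1. distinct [Kn 2 0 s n, Kn 2 1 t n, Mn s n] \<and>
                {F \<in> subfields_of (Kinf 2 1 t). has_degree F \<rat> (2 ^ n)} =
                  {Kn 2 0 s n, Kn 2 1 t n, Mn s n}) \<and>
        {(F, E). F \<in> subfields_of (Kinf 2 1 t) \<and> E \<in> subfields_of (Kinf 2 1 t) \<and> has_degree E F 2} =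
          {(\<rat>, Kn 2 0 s 1), (\<rat>, Kn 2 1 t 1), (\<rat>, Mn s 1), (Kinf 2 0 s, Kinf 2 1 t)} \<union>
          (\<Union>n\<in>{1..}. {(Kn 2 0 s n, Kn 2 0 s (n + 1)), (Kn 2 0 s n, Mn s (n + 1)),
                        (Kn 2 0 s n, Kn 2 1 t (n + 1)), (Mn s n, Kn 2 1 t (n + 1)),
                        (Kn 2 1 t n, Kn 2 1 t (n + 1))}) \<and>
        (\<forall>n\<ge>1. \<not> Mn s n \<subseteq> Mn s (n + 1)))"
  by (rule conjI, intro allI impI, rule proper_subfields_Omega_nonsquare, assumption+,
      rule conjI, intro allI impI, rule Omega_square_subfields, assumption+,
      rule conjI, rule infinite_Omega_square, intro allI, rule subfields_2_1)

end
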